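(* Let $a,b>0$ and $g\in L^2(\mathbb R)$. If $(g,a,b)$ is a Weyl-Heisenberg frame with frame operator $S$, then for all $f\in L^2(\mathbb R)$ $$S(f)=\frac1b\sum_{n\in\mathbb Z}\langle f,T_{na}g\rangle_{1/b}\,T_{na}g=\frac1b\sum_{n\in\mathbb Z}P_nf\cdot T_{na}\|g\|_{1/b}^2,$$ where $P_n$ is the orthogonal projection of $L^2(\mathbb R)$ onto $\operatorname{span}(E_{mb}T_{na}g)_{m\in\mathbb Z}$, and the series converges unconditionally in $L^2(\mathbb R)$.
   Context: $T_cf(x)=f(x-c)$, $E_cf(x)=e^{2\pi icx}f(x)$. $(g,a,b)$ denotes the system $(E_{mb}T_{na}g)_{m,n\in\mathbb Z}$; it is a Weyl-Heisenberg frame if there are $A,B>0$ with $A\|f\|^2\le\sum_{m,n\in\mathbb Z}|\langle f,E_{mb}T_{na}g\rangle|^2\le B\|f\|^2$ for all $f\in L^2(\mathbb R)$. Its frame operator is $Sf=\sum_{m,n\in\mathbb Z}\langle f,E_{mb}T_{na}g\rangle E_{mb}T_{na}g$. For $c>0$ and $f,h\in L^2(\mathbb R)$, $\langle f,h\rangle_c(t)=\sum_{n\in\mathbb Z}f(t-nc)\overline{h(t-nc)}$ (a $c$-periodic function, defined a.e.), and $\|f\|_c(t)=\sqrt{\langle f,f\rangle_c(t)}$. "span" denotes the closed linear span in $L^2(\mathbb R)$. *)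

theory Defs
  imports "HOL-Analysis.Analysis"
begin

text \<open>
  Elements of \<open>L\<^sup>2(\<real>)\<close> are represented by square-integrable Borel functions, not by
  equivalence classes; identities between elements of \<open>L\<^sup>2(\<real>)\<close> are therefore stated
  almost everywhere, and objects that are only determined as elements of \<open>L\<^sup>2(\<real>)\<close>
  (sums of series, orthogonal projections) are chosen representatives.
\<close>

definition L2 :: "(real \<Rightarrow> complex) set" where
  "L2 = {f \<in> borel_measurable lborel. integrable lborel (\<lambda>x. (cmod (f x))\<^sup>2)}"

definition l2_inner :: "(real \<Rightarrow> complex) \<Rightarrow> (real \<Rightarrow> complex) \<Rightarrow> complex" where
  "l2_inner f h = (LINT x|lborel. f x * cnj (h x))"

definition l2_norm :: "(real \<Rightarrow> complex) \<Rightarrow> real" where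
  "l2_norm f = sqrt (LINT x|lborel. (cmod (f x))\<^sup>2)"

text \<open>
  Unconditional convergence in \<open>L\<^sup>2(\<real>)\<close>, as convergence of the net of finite partial sums
  (this mirrors \<^const>\<open>has_sum\<close>, which is not applicable because \<^const>\<open>l2_norm\<close> is
  only a seminorm on functions).  Membership in \<open>L2\<close> is required explicitly since
  \<^const>\<open>l2_norm\<close> is \<open>0\<close> on functions that are not square-integrable.
\<close>

definition l2_has_sum :: "('i \<Rightarrow> real \<Rightarrow> complex) \<Rightarrow> (real \<Rightarrow> complex) \<Rightarrow> bool" where
  "l2_has_sum u h \<longleftrightarrow> (\<forall>i. u i \<in> L2) \<and> h \<in> L2 \<and>
     ((\<lambda>F. l2_norm (\<lambda>t. (\<Sum>i\<in>F. u i t) - h t)) \<longlongrightarrow> 0) (finite_subsets_at_top UNIV)"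

definition l2_summable :: "('i \<Rightarrow> real \<Rightarrow> complex) \<Rightarrow> bool" where
  "l2_summable u \<longleftrightarrow> (\<exists>h. l2_has_sum u h)"

definition l2_sum :: "('i \<Rightarrow> real \<Rightarrow> complex) \<Rightarrow> real \<Rightarrow> complex" where
  "l2_sum u = (SOME h. l2_has_sum u h)"

definition l2_closed_span :: "('i \<Rightarrow> real \<Rightarrow> complex) \<Rightarrow> (real \<Rightarrow> complex) set" where
  "l2_closed_span v = {h \<in> L2. \<forall>\<epsilon>>0. \<exists>F c. finite F \<and>
     l2_norm (\<lambda>t. h t - (\<Sum>i\<in>F. c i * v i t)) < \<epsilon>}"

definition orth_proj ::
    "(real \<Rightarrow> complex) set \<Rightarrow> (real \<Rightarrow> complex) \<Rightarrow> real \<Rightarrow> complex" where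
  "orth_proj V f = (SOME h. h \<in> V \<and> (\<forall>v\<in>V. l2_inner (\<lambda>t. f t - h t) v = 0))"

definition translation :: "real \<Rightarrow> (real \<Rightarrow> 'a) \<Rightarrow> real \<Rightarrow> 'a" where
  "translation c f = (\<lambda>x. f (x - c))"

definition modulation :: "real \<Rightarrow> (real \<Rightarrow> complex) \<Rightarrow> real \<Rightarrow> complex" where
  "modulation c f = (\<lambda>x. exp (2 * of_real pi * \<i> * of_real c * of_real x) * f x)"

definition wh_atom :: "(real \<Rightarrow> complex) \<Rightarrow> real \<Rightarrow> real \<Rightarrow> int \<Rightarrow> int \<Rightarrow> real \<Rightarrow> complex" where
  "wh_atom g a b m n = modulation (of_int m * b) (translation (of_int n * a) g)"

definition wh_frame :: "(real \<Rightarrow> complex) \<Rightarrow> real \<Rightarrow> real \<Rightarrow> bool" where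
  "wh_frame g a b \<longleftrightarrow> (\<exists>A>0. \<exists>B>0. \<forall>f\<in>L2.
     (\<lambda>(m, n). (cmod (l2_inner f (wh_atom g a b m n)))\<^sup>2) summable_on UNIV \<and>
     A * (l2_norm f)\<^sup>2 \<le> (\<Sum>\<^sub>\<infinity>(m, n). (cmod (l2_inner f (wh_atom g a b m n)))\<^sup>2) \<and>
     (\<Sum>\<^sub>\<infinity>(m, n). (cmod (l2_inner f (wh_atom g a b m n)))\<^sup>2) \<le> B * (l2_norm f)\<^sup>2)"

definition frame_operator ::
    "(real \<Rightarrow> complex) \<Rightarrow> real \<Rightarrow> real \<Rightarrow> (real \<Rightarrow> complex) \<Rightarrow> real \<Rightarrow> complex" where
  "frame_operator g a b f =
     l2_sum (\<lambda>(m, n) t. l2_inner f (wh_atom g a b m n) * wh_atom g a b m n t)"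

text \<open>For \<open>f, h \<in> L2\<close> the series below converges absolutely for almost every \<open>t\<close>.\<close>

definition bracket :: "real \<Rightarrow> (real \<Rightarrow> complex) \<Rightarrow> (real \<Rightarrow> complex) \<Rightarrow> real \<Rightarrow> complex" where
  "bracket c f h t = (\<Sum>\<^sub>\<infinity>n::int. f (t - of_int n * c) * cnj (h (t - of_int n * c)))"

definition bracket_norm :: "real \<Rightarrow> (real \<Rightarrow> complex) \<Rightarrow> real \<Rightarrow> real" where
  "bracket_norm c f t = sqrt (Re (bracket c f f t))"

definition wh_proj ::
    "(real \<Rightarrow> complex) \<Rightarrow> real \<Rightarrow> real \<Rightarrow> int \<Rightarrow> (real \<Rightarrow> complex) \<Rightarrow> real \<Rightarrow> complex" where
  "wh_proj g a b n = orth_proj (l2_closed_span (\<lambda>m. wh_atom g a b m n))"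

end

(*
  For fixed n, put h = T_{na} g and let w be the 1/b-periodization of |h|^2.  The coefficients of f
  against the modulates of h are the Fourier coefficients over one period of the bracket <f, h>_{1/b}.
  The Bessel bound, tested on trigonometric polynomials, gives w <= B b almost everywhere, so
  multiplication by h is bounded from L^2 of a period to L^2(R) and carries the Fourier series of the
  bracket to an L^2-convergent series with sum (1/b) <f, h>_{1/b} h.  The series defining S f converges
  unconditionally, so its terms may be grouped by n; this is the first formula.  The projection of f
  onto the span of the modulates of h is (<f, h>_{1/b} / w) h, and multiplying it by w gives the second.
*)
theory Submission
  imports Defs
begin

section \<open>The space of square-integrable functions\<close>

text \<open>The pivot is the bound on w. The bracket of two arbitrary square-integrable functions is
  only integrable over a period and need not have an L^2-convergent Fourier series; Cauchy-Schwarz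
  and the bound on w put it into L^2 of the period. Folding the line onto one period turns the norm
  of a product of \<open>h\<close> with a periodic factor into the norm of that factor with weight
  w, so statements about modulates become statements about a single period. The factor 1/b is the
  squared norm of a character on a period of length 1/b: the coefficients in S f lack the
  normalising factor b. The projection is the delicate point, since w may vanish or come close to 0
  and the quotient may be unbounded. Cauchy-Schwarz forces the bracket to vanish almost everywhere
  where w does, and truncating the quotient brings it within reach of trigonometric polynomials.
  Almost everywhere the second series has the same terms as the first, so it inherits both
  convergence and sum.\<close>

lemma L2_measurable [measurable_dest]: "f \<in> L2 \<Longrightarrow> f \<in> borel_measurable lborel"
  by (simp add: L2_def)

lemma L2_integrable: "f \<in> L2 \<Longrightarrow> integrable lborel (\<lambda>x. (cmod (f x))\<^sup>2)"
  by (simp add: L2_def)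

lemma L2_iff_nn_integral:
  "f \<in> L2 \<longleftrightarrow> f \<in> borel_measurable lborel \<and> (\<integral>\<^sup>+x. ennreal ((cmod (f x))\<^sup>2) \<partial>lborel) < \<infinity>"
  unfolding L2_def by (auto simp: integrable_iff_bounded)

lemma l2_norm_nonneg [simp]: "0 \<le> l2_norm f"
  by (simp add: l2_norm_def)

lemma l2_norm_sq: "(l2_norm f)\<^sup>2 = (LINT x|lborel. (cmod (f x))\<^sup>2)"
  by (simp add: l2_norm_def)

lemma nn_integral_l2_norm:
  "f \<in> L2 \<Longrightarrow> (\<integral>\<^sup>+x. ennreal ((cmod (f x))\<^sup>2) \<partial>lborel) = ennreal ((l2_norm f)\<^sup>2)"
  unfolding l2_norm_sq by (rule nn_integral_eq_integral) (auto dest: L2_integrable)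

text \<open>\<open>l2_norm\<close> is 0 when the squared modulus is not integrable, so a bound on it
  alone says nothing about membership. One estimate of the extended nonnegative integral settles
  both.\<close>

lemma L2_and_l2_norm_leI:
  assumes "f \<in> borel_measurable lborel" "0 \<le> C"
    and "(\<integral>\<^sup>+x. ennreal ((cmod (f x))\<^sup>2) \<partial>lborel) \<le> ennreal (C\<^sup>2)"
  shows "f \<in> L2" "l2_norm f \<le> C"
proof -
  show f: "f \<in> L2"
    using assms by (auto simp: L2_iff_nn_integral intro: le_less_trans)
  have "(l2_norm f)\<^sup>2 \<le> C\<^sup>2"
    using assms(3) unfolding nn_integral_l2_norm[OF f] by simp
  then show "l2_norm f \<le> C"
    using assms(2) power2_le_imp_le by blast
qed

text \<open>\<open>lborel\<close> is not complete, so almost everywhere equality does not carry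
  Borel measurability over; it has to be supplied for \<open>h\<close>.\<close>

lemma l2_norm_cong_AE:
  assumes "f \<in> L2" "h \<in> borel_measurable lborel" "AE x in lborel. f x = h x"
  shows "h \<in> L2" "l2_norm h = l2_norm f"
proof -
  have [measurable]: "f \<in> borel_measurable borel" "h \<in> borel_measurable borel"
    using assms by (auto dest: L2_measurable)
  have "(\<integral>\<^sup>+x. ennreal ((cmod (h x))\<^sup>2) \<partial>lborel) = (\<integral>\<^sup>+x. ennreal ((cmod (f x))\<^sup>2) \<partial>lborel)"
    using assms(3) by (intro nn_integral_cong_AE) auto
  then show "h \<in> L2"
    using assms by (simp add: L2_iff_nn_integral)
  show "l2_norm h = l2_norm f"
    unfolding l2_norm_def using assms(3) by (intro arg_cong[where f=sqrt] integral_cong_AE) auto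
qed

lemma borel_measurable_cnj [measurable (raw)]:
  "f \<in> borel_measurable M \<Longrightarrow> (\<lambda>x. cnj (f x)) \<in> borel_measurable M"
  by (rule borel_measurable_continuous_on[of cnj]) (auto intro: continuous_intros)

text \<open>The measure is arbitrary because two instances are needed: Lebesgue measure for
  \<open>l2_inner\<close>, and counting measure on the integers for the bracket at a fixed
  point.\<close>

lemma Cauchy_Schwarz_integral:
  fixes f h :: "'a \<Rightarrow> complex"
  assumes [measurable]: "f \<in> borel_measurable M" "h \<in> borel_measurable M"
    and f: "integrable M (\<lambda>x. (cmod (f x))\<^sup>2)" and h: "integrable M (\<lambda>x. (cmod (h x))\<^sup>2)"
  shows "integrable M (\<lambda>x. f x * cnj (h x))"
    and "(cmod (LINT x|M. f x * cnj (h x)))\<^sup>2 \<le> (LINT x|M. (cmod (f x))\<^sup>2) * (LINT x|M. (cmod (h x))\<^sup>2)"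
proof -
  let ?N = "\<integral>\<^sup>+x. ennreal (cmod (f x * cnj (h x))) \<partial>M"
  have "?N\<^sup>2 = (\<integral>\<^sup>+x. ennreal (cmod (f x)) * ennreal (cmod (h x)) \<partial>M)\<^sup>2"
    by (simp add: norm_mult ennreal_mult)
  also have "\<dots> \<le> (\<integral>\<^sup>+x. ennreal (cmod (f x)) ^ 2 \<partial>M) * (\<integral>\<^sup>+x. ennreal (cmod (h x)) ^ 2 \<partial>M)"
    by (rule Cauchy_Schwarz_nn_integral) measurable
  also have "(\<integral>\<^sup>+x. ennreal (cmod (f x)) ^ 2 \<partial>M) = ennreal (LINT x|M. (cmod (f x))\<^sup>2)"
    by (simp add: ennreal_power nn_integral_eq_integral f)
  also have "(\<integral>\<^sup>+x. ennreal (cmod (h x)) ^ 2 \<partial>M) = ennreal (LINT x|M. (cmod (h x))\<^sup>2)"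
    by (simp add: ennreal_power nn_integral_eq_integral h)
  finally have *: "?N\<^sup>2 \<le> ennreal ((LINT x|M. (cmod (f x))\<^sup>2) * (LINT x|M. (cmod (h x))\<^sup>2))"
    by (simp add: ennreal_mult)
  then have "?N\<^sup>2 < \<infinity>"
    by (auto intro: le_less_trans)
  then have "?N < \<infinity>"
    by (cases "?N = top") (auto simp: power2_eq_square ennreal_mult_eq_top_iff less_top)
  then show int: "integrable M (\<lambda>x. f x * cnj (h x))"
    by (intro integrableI_bounded) auto
  have nonneg: "0 \<le> (LINT x|M. (cmod (f x))\<^sup>2) * (LINT x|M. (cmod (h x))\<^sup>2)"
    by (intro mult_nonneg_nonneg Bochner_Integration.integral_nonneg) auto
  have "ennreal ((cmod (LINT x|M. f x * cnj (h x)))\<^sup>2) = (ennreal (cmod (LINT x|M. f x * cnj (h x))))\<^sup>2"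
    by (simp add: ennreal_power)
  also have "\<dots> \<le> ?N\<^sup>2"
    by (intro power_mono integral_norm_bound_ennreal int) auto
  also note *
  finally show "(cmod (LINT x|M. f x * cnj (h x)))\<^sup>2 \<le> (LINT x|M. (cmod (f x))\<^sup>2) * (LINT x|M. (cmod (h x))\<^sup>2)"
    using nonneg by (simp only: ennreal_le_iff)
qed

lemma l2_inner_integrable:
  "f \<in> L2 \<Longrightarrow> h \<in> L2 \<Longrightarrow> integrable lborel (\<lambda>x. f x * cnj (h x))"
  by (intro Cauchy_Schwarz_integral(1)) (auto dest: L2_measurable L2_integrable)

lemma l2_Cauchy_Schwarz:
  assumes "f \<in> L2" "h \<in> L2"
  shows "cmod (l2_inner f h) \<le> l2_norm f * l2_norm h"
proof -
  have "(cmod (l2_inner f h))\<^sup>2 \<le> (l2_norm f * l2_norm h)\<^sup>2"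
    unfolding l2_inner_def power_mult_distrib l2_norm_sq
    using assms by (intro Cauchy_Schwarz_integral(2)) (auto dest: L2_measurable L2_integrable)
  then show ?thesis
    by (rule power2_le_imp_le) simp
qed

section \<open>Closure of \<open>L2\<close> under linear operations and bounded multipliers\<close>

lemma L2_zero [simp]: "(\<lambda>x. 0) \<in> L2"
  by (simp add: L2_def)

lemma L2_add:
  assumes "f \<in> L2" "h \<in> L2"
  shows "(\<lambda>x. f x + h x) \<in> L2"
proof -
  have [measurable]: "f \<in> borel_measurable borel" "h \<in> borel_measurable borel"
    using assms by (auto dest: L2_measurable)
  have "integrable lborel (\<lambda>x. 2 * (cmod (f x))\<^sup>2 + 2 * (cmod (h x))\<^sup>2)"
    using assms by (intro Bochner_Integration.integrable_add integrable_mult_right) (auto dest: L2_integrable)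
  moreover have "(cmod (f x + h x))\<^sup>2 \<le> 2 * (cmod (f x))\<^sup>2 + 2 * (cmod (h x))\<^sup>2" for x
  proof -
    have "(cmod (f x + h x))\<^sup>2 \<le> (cmod (f x) + cmod (h x))\<^sup>2"
      by (intro power_mono norm_triangle_ineq) auto
    also have "\<dots> \<le> 2 * (cmod (f x))\<^sup>2 + 2 * (cmod (h x))\<^sup>2"
      using sum_squares_bound[of "cmod (f x)" "cmod (h x)"] by (simp add: power2_sum)
    finally show ?thesis .
  qed
  ultimately have "integrable lborel (\<lambda>x. (cmod (f x + h x))\<^sup>2)"
    by (elim Bochner_Integration.integrable_bound) auto
  then show ?thesis
    by (simp add: L2_def)
qed

text \<open>Scalars, indicators, characters, trigonometric polynomials and truncated weights all act
  on \<open>L2\<close> through this one bound.\<close>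

lemma L2_mult_bounded:
  assumes "f \<in> L2" "\<phi> \<in> borel_measurable lborel" "0 \<le> K" "AE x in lborel. cmod (\<phi> x) \<le> K"
  shows "(\<lambda>x. \<phi> x * f x) \<in> L2" "l2_norm (\<lambda>x. \<phi> x * f x) \<le> K * l2_norm f"
proof -
  have [measurable]: "f \<in> borel_measurable borel" "\<phi> \<in> borel_measurable borel"
    using assms by (auto dest: L2_measurable)
  have "(\<integral>\<^sup>+x. ennreal ((cmod (\<phi> x * f x))\<^sup>2) \<partial>lborel) \<le> (\<integral>\<^sup>+x. ennreal (K\<^sup>2) * ennreal ((cmod (f x))\<^sup>2) \<partial>lborel)"
    using assms(4)
    by (intro nn_integral_mono_AE, eventually_elim)
       (auto simp: norm_mult power_mult_distrib ennreal_mult'[symmetric] intro!: ennreal_leI mult_right_mono power_mono)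
  also have "\<dots> = ennreal (K\<^sup>2) * ennreal ((l2_norm f)\<^sup>2)"
    by (subst nn_integral_cmult) (use nn_integral_l2_norm[OF assms(1)] in auto)
  also have "\<dots> = ennreal ((K * l2_norm f)\<^sup>2)"
    by (simp add: ennreal_mult' power_mult_distrib)
  finally have *: "(\<integral>\<^sup>+x. ennreal ((cmod (\<phi> x * f x))\<^sup>2) \<partial>lborel) \<le> \<dots>" .
  show "(\<lambda>x. \<phi> x * f x) \<in> L2" "l2_norm (\<lambda>x. \<phi> x * f x) \<le> K * l2_norm f"
    using L2_and_l2_norm_leI[OF _ _ *] assms(3) by auto
qed

lemma L2_cmult: "f \<in> L2 \<Longrightarrow> (\<lambda>x. c * f x) \<in> L2"
  by (rule L2_mult_bounded(1)[where K="cmod c"]) auto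

lemma L2_diff: "f \<in> L2 \<Longrightarrow> h \<in> L2 \<Longrightarrow> (\<lambda>x. f x - h x) \<in> L2"
  using L2_add[of f "\<lambda>x. (-1) * h x"] L2_cmult[of h "-1"] by simp

lemma L2_sum: "(\<And>i. i \<in> F \<Longrightarrow> u i \<in> L2) \<Longrightarrow> (\<lambda>x. \<Sum>i\<in>F. u i x) \<in> L2"
  by (induction F rule: infinite_finite_induct) (auto intro: L2_add)

lemma L2_indicator_mult:
  assumes "f \<in> L2" "A \<in> sets lborel"
  shows "(\<lambda>x. indicator A x * f x) \<in> L2"
  using assms by (intro L2_mult_bounded(1)[where K=1]) (auto split: split_indicator)

section \<open>Algebra of the norm and the inner product\<close>

lemma l2_norm_cmult: "l2_norm (\<lambda>x. c * f x) = cmod c * l2_norm f"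
  by (simp add: l2_norm_def norm_mult power_mult_distrib real_sqrt_mult)

lemma l2_norm_minus_commute: "l2_norm (\<lambda>x. f x - h x) = l2_norm (\<lambda>x. h x - f x)"
  by (simp add: l2_norm_def norm_minus_commute)

lemma l2_inner_cnj: "l2_inner h f = cnj (l2_inner f h)"
  unfolding l2_inner_def by (subst Bochner_Integration.integral_cnj[symmetric]) (simp add: mult.commute)

lemma l2_inner_self: "l2_inner f f = of_real ((l2_norm f)\<^sup>2)"
  unfolding l2_inner_def l2_norm_sq by (simp flip: complex_norm_square integral_complex_of_real)

lemma l2_inner_diff_left:
  "f \<in> L2 \<Longrightarrow> g \<in> L2 \<Longrightarrow> h \<in> L2 \<Longrightarrow> l2_inner (\<lambda>x. f x - g x) h = l2_inner f h - l2_inner g h"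
  unfolding l2_inner_def left_diff_distrib by (intro Bochner_Integration.integral_diff l2_inner_integrable)

lemma l2_inner_cmult_left: "l2_inner (\<lambda>x. c * f x) h = c * l2_inner f h"
  unfolding l2_inner_def mult.assoc by simp

lemma l2_inner_sum_left:
  assumes "\<And>i. i \<in> F \<Longrightarrow> u i \<in> L2" "h \<in> L2"
  shows "l2_inner (\<lambda>x. \<Sum>i\<in>F. u i x) h = (\<Sum>i\<in>F. l2_inner (u i) h)"
  unfolding l2_inner_def sum_distrib_right
  by (intro Bochner_Integration.integral_sum l2_inner_integrable assms)

lemma l2_inner_sum_right:
  assumes "\<And>i. i \<in> F \<Longrightarrow> u i \<in> L2" "h \<in> L2"
  shows "l2_inner h (\<lambda>x. \<Sum>i\<in>F. u i x) = (\<Sum>i\<in>F. l2_inner h (u i))"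
  by (subst l2_inner_cnj, subst l2_inner_sum_left) (auto simp: assms l2_inner_cnj[of h])

lemma l2_inner_diff_right:
  "f \<in> L2 \<Longrightarrow> g \<in> L2 \<Longrightarrow> h \<in> L2 \<Longrightarrow> l2_inner h (\<lambda>x. f x - g x) = l2_inner h f - l2_inner h g"
  by (subst l2_inner_cnj, subst l2_inner_diff_left) (auto simp: l2_inner_cnj[of h])

lemma l2_inner_cmult_right: "l2_inner h (\<lambda>x. c * f x) = cnj c * l2_inner h f"
  by (subst l2_inner_cnj, subst l2_inner_cmult_left) (auto simp: l2_inner_cnj[of h])

lemma l2_norm_add_sq:
  assumes "f \<in> L2" "h \<in> L2"
  shows "(l2_norm (\<lambda>x. f x + h x))\<^sup>2 = (l2_norm f)\<^sup>2 + 2 * Re (l2_inner f h) + (l2_norm h)\<^sup>2"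
proof -
  have "(l2_norm (\<lambda>x. f x + h x))\<^sup>2
      = (LINT x|lborel. ((cmod (f x))\<^sup>2 + 2 * Re (f x * cnj (h x))) + (cmod (h x))\<^sup>2)"
    unfolding l2_norm_sq
    by (intro Bochner_Integration.integral_cong) (auto simp: cmod_power2 power2_sum algebra_simps)
  also have "\<dots> = (LINT x|lborel. (cmod (f x))\<^sup>2 + 2 * Re (f x * cnj (h x))) + (l2_norm h)\<^sup>2"
    unfolding l2_norm_sq using assms l2_inner_integrable[OF assms]
    by (intro Bochner_Integration.integral_add Bochner_Integration.integrable_add L2_integrable
         integrable_mult_right integrable_Re) auto
  also have "(LINT x|lborel. (cmod (f x))\<^sup>2 + 2 * Re (f x * cnj (h x)))
      = (l2_norm f)\<^sup>2 + (LINT x|lborel. 2 * Re (f x * cnj (h x)))"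
    unfolding l2_norm_sq using assms l2_inner_integrable[OF assms]
    by (intro Bochner_Integration.integral_add L2_integrable integrable_mult_right integrable_Re) auto
  also have "(LINT x|lborel. 2 * Re (f x * cnj (h x))) = 2 * Re (l2_inner f h)"
    unfolding l2_inner_def using l2_inner_integrable[OF assms] by (simp only: integral_mult_right_zero integral_Re)
  finally show ?thesis .
qed

lemma l2_norm_triangle:
  assumes "f \<in> L2" "h \<in> L2"
  shows "l2_norm (\<lambda>x. f x + h x) \<le> l2_norm f + l2_norm h"
proof -
  have "Re (l2_inner f h) \<le> l2_norm f * l2_norm h"
    using l2_Cauchy_Schwarz[OF assms] complex_Re_le_cmod order_trans by blast
  then have "(l2_norm (\<lambda>x. f x + h x))\<^sup>2 \<le> (l2_norm f + l2_norm h)\<^sup>2"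
    unfolding l2_norm_add_sq[OF assms] by (simp add: power2_sum)
  then show ?thesis
    by (rule power2_le_imp_le) simp
qed

lemma l2_norm_triangle_mid:
  assumes "f \<in> L2" "g \<in> L2" "h \<in> L2"
  shows "l2_norm (\<lambda>x. f x - h x) \<le> l2_norm (\<lambda>x. f x - g x) + l2_norm (\<lambda>x. g x - h x)"
  using l2_norm_triangle[OF L2_diff[OF assms(1,2)] L2_diff[OF assms(2,3)]] by simp

lemma l2_norm_sum_le:
  assumes "\<And>i. i \<in> F \<Longrightarrow> u i \<in> L2"
  shows "l2_norm (\<lambda>x. \<Sum>i\<in>F. u i x) \<le> (\<Sum>i\<in>F. l2_norm (u i))"
  using assms
proof (induction F rule: infinite_finite_induct)
  case (insert i F)
  then show ?case
    using l2_norm_triangle[of "u i" "\<lambda>x. \<Sum>i\<in>F. u i x"] L2_sum[of F u] by fastforce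
qed (auto simp: l2_norm_def)

lemma l2_norm_eq_0_imp_AE:
  assumes "f \<in> L2" "l2_norm f = 0"
  shows "AE x in lborel. f x = 0"
  using assms integral_nonneg_eq_0_iff_AE[OF L2_integrable[OF assms(1)]]
  by (simp add: l2_norm_def)

text \<open>
  Riesz--Fischer: along a subsequence with summable increments the pointwise sum of the
  increments is square-integrable, hence finite almost everywhere.
\<close>

lemma L2_complete:
  fixes u :: "nat \<Rightarrow> real \<Rightarrow> complex"
  assumes u: "\<And>n. u n \<in> L2"
    and Cauchy: "\<And>e. e > 0 \<Longrightarrow> \<exists>N. \<forall>m\<ge>N. \<forall>n\<ge>N. l2_norm (\<lambda>x. u m x - u n x) < e"
  shows "\<exists>h\<in>L2. (\<lambda>n. l2_norm (\<lambda>x. u n x - h x)) \<longlonglongrightarrow> 0"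
proof -
  have um [measurable]: "u n \<in> borel_measurable borel" for n
    using u[of n] by (auto dest: L2_measurable)
  obtain N where N: "\<And>k m n. m \<ge> N k \<Longrightarrow> n \<ge> N k \<Longrightarrow> l2_norm (\<lambda>x. u m x - u n x) < (1/2)^k"
    using Cauchy[of "(1/2)^k" for k] by (metis zero_less_power half_gt_zero_iff zero_less_one)
  \<comment> \<open>Summing the thresholds makes them monotone in \<open>k\<close>, while each still
    dominates \<open>N k\<close>.\<close>
  define r where "r k = (\<Sum>j\<le>k. N j)" for k
  have r_mono: "r j \<le> r k" if "j \<le> k" for j k
    unfolding r_def using that by (intro sum_mono2) auto
  have r_ge: "N k \<le> r k" for k
    unfolding r_def by (rule member_le_sum) auto
  define v where "v k = u (r k)" for k
  have v: "v k \<in> L2" for k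
    by (simp add: v_def u)
  have vm [measurable]: "v k \<in> borel_measurable borel" for k
    by (simp add: v_def)
  have v_diff: "l2_norm (\<lambda>x. v j x - v k x) < (1/2)^k" if "j \<ge> k" for j k
    unfolding v_def using that r_mono r_ge order_trans by (intro N) blast+
  define G where "G n x = (\<Sum>k<n. cmod (v (Suc k) x - v k x))" for n x
  have Gm [measurable]: "G n \<in> borel_measurable borel" for n
    by (simp add: G_def[abs_def])
  have G_nonneg: "0 \<le> G n x" for n x
    by (auto simp: G_def intro: sum_nonneg)
  have G_bound: "(\<integral>\<^sup>+x. ennreal ((G n x)\<^sup>2) \<partial>lborel) \<le> 4" for n
  proof -
    \<comment> \<open>The moduli are read as complex-valued functions so that the triangle
      inequality for \<open>l2_norm\<close> applies to their sum.\<close>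
    let ?d = "\<lambda>k x. complex_of_real (cmod (v (Suc k) x - v k x))"
    have d: "?d k \<in> L2" for k
      using L2_diff[OF v v, of "Suc k" k] by (simp add: L2_def)
    have "l2_norm (\<lambda>x. \<Sum>k<n. ?d k x) \<le> (\<Sum>k<n. l2_norm (?d k))"
      by (rule l2_norm_sum_le) (rule d)
    also have "\<dots> \<le> (\<Sum>k<n. (1/2)^k)"
      using v_diff[of k "Suc k" for k] by (intro sum_mono) (auto simp: l2_norm_def intro: less_imp_le)
    also have "\<dots> \<le> (\<Sum>k. (1/2)^k)"
      by (intro sum_le_suminf) auto
    also have "\<dots> = 2"
      by (simp add: suminf_geometric)
    finally have "(l2_norm (\<lambda>x. \<Sum>k<n. ?d k x))\<^sup>2 \<le> 2\<^sup>2"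
      by (intro power_mono) auto
    then have "ennreal ((l2_norm (\<lambda>x. \<Sum>k<n. ?d k x))\<^sup>2) \<le> ennreal 4"
      by (intro ennreal_leI) simp
    moreover have "(cmod (\<Sum>k<n. ?d k x))\<^sup>2 = (G n x)\<^sup>2" for x
      unfolding G_def of_real_sum[symmetric] norm_of_real by simp
    ultimately show ?thesis
      using nn_integral_l2_norm[OF L2_sum[of "{..<n}" ?d]] d by simp
  qed
  have "AE x in lborel. (SUP n. ennreal ((G n x)\<^sup>2)) \<noteq> \<infinity>"
  proof (rule nn_integral_PInf_AE)
    have "(\<integral>\<^sup>+x. (SUP n. ennreal ((G n x)\<^sup>2)) \<partial>lborel) = (SUP n. \<integral>\<^sup>+x. ennreal ((G n x)\<^sup>2) \<partial>lborel)"
      by (rule nn_integral_monotone_convergence_SUP)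
         (auto simp: mono_def le_fun_def G_def intro!: ennreal_leI power_mono sum_mono2 sum_nonneg incseq_SucI)
    also have "\<dots> \<le> 4"
      by (intro SUP_least G_bound)
    finally show "(\<integral>\<^sup>+x. (SUP n. ennreal ((G n x)\<^sup>2)) \<partial>lborel) \<noteq> \<infinity>"
      by (auto simp: top_unique)
  qed measurable
  then have conv: "AE x in lborel. convergent (\<lambda>k. v k x)"
  proof eventually_elim
    case (elim x)
    then obtain B where B: "(SUP n. ennreal ((G n x)\<^sup>2)) = ennreal B" "0 \<le> B"
      by (cases "SUP n. ennreal ((G n x)\<^sup>2)") auto
    have "G n x \<le> sqrt B" for n
    proof -
      have "ennreal ((G n x)\<^sup>2) \<le> ennreal B"
        unfolding B(1)[symmetric] by (rule SUP_upper) simp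
      then show ?thesis
        using B(2) G_nonneg[of n x] real_le_rsqrt by (simp add: ennreal_le_iff)
    qed
    then have "summable (\<lambda>k. cmod (v (Suc k) x - v k x))"
      unfolding G_def by (intro bounded_imp_summable[where B="sqrt B"]) (auto simp: lessThan_Suc_atMost[symmetric] simp del: sum.lessThan_Suc)
    then have "summable (\<lambda>k. v (Suc k) x - v k x)"
      by (rule summable_norm_cancel)
    then have "convergent (\<lambda>n. \<Sum>k<n. v (Suc k) x - v k x)"
      by (simp add: summable_iff_convergent)
    then have "convergent (\<lambda>n. v n x - v 0 x)"
      using sum_lessThan_telescope[of "\<lambda>k. v k x"] by simp
    from convergent_add[OF this convergent_const[of "v 0 x"]]
    show ?case by simp
  qed
  define h where "h x = lim (\<lambda>k. v k x)" for x
  have hm [measurable]: "h \<in> borel_measurable borel"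
    unfolding h_def[abs_def] by measurable
  have lim: "AE x in lborel. (\<lambda>k. v k x) \<longlonglongrightarrow> h x"
    using conv by eventually_elim (simp add: h_def convergent_LIMSEQ_iff)
  \<comment> \<open>Fatou's lemma in \<open>j\<close> carries the bound on \<open>v j - v k\<close>
    over to the limit \<open>h - v k\<close>; this also places \<open>h\<close> in
    \<open>L2\<close>.\<close>
  have tail: "(\<lambda>x. h x - v k x) \<in> L2 \<and> l2_norm (\<lambda>x. h x - v k x) \<le> (1/2)^k" for k
  proof -
    have "(\<integral>\<^sup>+x. ennreal ((cmod (h x - v k x))\<^sup>2) \<partial>lborel)
        = (\<integral>\<^sup>+x. liminf (\<lambda>j. ennreal ((cmod (v j x - v k x))\<^sup>2)) \<partial>lborel)"
      using lim
    proof (intro nn_integral_cong_AE, eventually_elim)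
      case (elim x)
      have "(\<lambda>j. ennreal ((cmod (v j x - v k x))\<^sup>2)) \<longlonglongrightarrow> ennreal ((cmod (h x - v k x))\<^sup>2)"
        using elim by (intro tendsto_ennrealI tendsto_intros)
      then show ?case
        by (metis lim_imp_Liminf sequentially_bot)
    qed
    also have "\<dots> \<le> liminf (\<lambda>j. \<integral>\<^sup>+x. ennreal ((cmod (v j x - v k x))\<^sup>2) \<partial>lborel)"
      by (rule nn_integral_liminf) measurable
    also have "\<dots> \<le> ennreal (((1/2)^k)\<^sup>2)"
    proof (rule Liminf_le)
      have "(\<integral>\<^sup>+x. ennreal ((cmod (v j x - v k x))\<^sup>2) \<partial>lborel) \<le> ennreal (((1/2)^k)\<^sup>2)" if "j \<ge> k" for j
        using v_diff[OF that] nn_integral_l2_norm[OF L2_diff[OF v[of j] v[of k]]]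
        by (auto intro!: ennreal_leI power_mono less_imp_le)
      then show "\<forall>\<^sub>F j in sequentially. (\<integral>\<^sup>+x. ennreal ((cmod (v j x - v k x))\<^sup>2) \<partial>lborel) \<le> ennreal (((1/2)^k)\<^sup>2)"
        by (auto simp: eventually_sequentially)
    qed simp
    finally show ?thesis
      using L2_and_l2_norm_leI[of "\<lambda>x. h x - v k x" "(1/2)^k"] by auto
  qed
  have h: "h \<in> L2"
    using L2_add[OF conjunct1[OF tail[of 0]] v[of 0]] by simp
  have "(\<lambda>n. l2_norm (\<lambda>x. u n x - h x)) \<longlonglongrightarrow> 0"
  proof (rule LIMSEQ_I)
    fix e :: real assume "e > 0"
    then obtain k where k: "(1/2::real)^k < e/2"
      using real_arch_pow_inv[of "e/2" "1/2"] by auto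
    have "norm (l2_norm (\<lambda>x. u n x - h x) - 0) < e" if "n \<ge> N k" for n
    proof -
      have "l2_norm (\<lambda>x. u n x - h x) \<le> l2_norm (\<lambda>x. u n x - v k x) + l2_norm (\<lambda>x. v k x - h x)"
        by (intro l2_norm_triangle_mid u v h)
      also have "l2_norm (\<lambda>x. u n x - v k x) < (1/2)^k"
        unfolding v_def by (intro N that r_ge)
      also have "l2_norm (\<lambda>x. v k x - h x) \<le> (1/2)^k"
        using tail[of k] by (simp add: l2_norm_minus_commute)
      finally show ?thesis
        using k by simp
    qed
    then show "\<exists>no. \<forall>n\<ge>no. norm (l2_norm (\<lambda>x. u n x - h x) - 0) < e" by blast
  qed
  with h show ?thesis by blast
qed

section \<open>Unconditionally convergent series\<close>

lemma l2_has_sum_iff: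
  "l2_has_sum u h \<longleftrightarrow> (\<forall>i. u i \<in> L2) \<and> h \<in> L2 \<and>
     (\<forall>e>0. \<exists>A. finite A \<and> (\<forall>F. finite F \<and> A \<subseteq> F \<longrightarrow> l2_norm (\<lambda>t. (\<Sum>i\<in>F. u i t) - h t) < e))"
  unfolding l2_has_sum_def tendsto_iff eventually_finite_subsets_at_top by (simp add: dist_norm)

lemma l2_has_sumD:
  assumes "l2_has_sum u h" "e > 0"
  obtains A where "finite A"
    "\<And>F. finite F \<Longrightarrow> A \<subseteq> F \<Longrightarrow> l2_norm (\<lambda>t. (\<Sum>i\<in>F. u i t) - h t) < e"
proof -
  have "\<exists>A. finite A \<and> (\<forall>F. finite F \<and> A \<subseteq> F \<longrightarrow> l2_norm (\<lambda>t. (\<Sum>i\<in>F. u i t) - h t) < e)"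
    using assms unfolding l2_has_sum_iff by simp
  then show thesis
    using that by (elim exE conjE) simp
qed

lemma l2_has_sum_l2_sum: "l2_summable u \<Longrightarrow> l2_has_sum u (l2_sum u)"
  unfolding l2_summable_def l2_sum_def by (metis someI_ex)

lemma l2_has_sum_unique:
  assumes "l2_has_sum u h" "l2_has_sum u h'"
  shows "AE t in lborel. h t = h' t"
proof -
  have L: "h \<in> L2" "h' \<in> L2" "\<And>i. u i \<in> L2"
    using assms by (auto simp: l2_has_sum_def)
  have "l2_norm (\<lambda>t. h t - h' t) \<le> e" if "e > 0" for e
  proof -
    obtain A where A: "finite A"
      "\<And>F. finite F \<Longrightarrow> A \<subseteq> F \<Longrightarrow> l2_norm (\<lambda>t. (\<Sum>i\<in>F. u i t) - h t) < e/2"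
      using l2_has_sumD[OF assms(1), of "e/2"] \<open>e > 0\<close> by auto
    obtain A' where A': "finite A'"
      "\<And>F. finite F \<Longrightarrow> A' \<subseteq> F \<Longrightarrow> l2_norm (\<lambda>t. (\<Sum>i\<in>F. u i t) - h' t) < e/2"
      using l2_has_sumD[OF assms(2), of "e/2"] \<open>e > 0\<close> by auto
    let ?s = "\<lambda>t. \<Sum>i\<in>A \<union> A'. u i t"
    have "l2_norm (\<lambda>t. h t - h' t) \<le> l2_norm (\<lambda>t. h t - ?s t) + l2_norm (\<lambda>t. ?s t - h' t)"
      by (intro l2_norm_triangle_mid L L2_sum)
    also have "\<dots> < e/2 + e/2"
      unfolding l2_norm_minus_commute[of h] using A A' by (intro add_strict_mono) auto
    finally show ?thesis by simp
  qed
  then have "l2_norm (\<lambda>t. h t - h' t) \<le> 0 + e" if "e > 0" for e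
    using that by simp
  then have "l2_norm (\<lambda>t. h t - h' t) \<le> 0"
    by (rule field_le_epsilon)
  then have "l2_norm (\<lambda>t. h t - h' t) = 0"
    using l2_norm_nonneg order_antisym by fast
  then show ?thesis
    using l2_norm_eq_0_imp_AE[OF L2_diff[OF L(1,2)]] by simp
qed

text \<open>A finite partial sum meets only finitely many exceptional null sets, so its distance to
  \<open>h\<close> is unchanged. This moves convergence from the bracket series to the projection
  series.\<close>

lemma l2_has_sum_cong_AE:
  assumes "l2_has_sum u h" "\<And>i. v i \<in> L2" "\<And>i. AE t in lborel. v i t = u i t"
  shows "l2_has_sum v h"
proof -
  have L: "h \<in> L2" "\<And>i. u i \<in> L2"
    using assms by (auto simp: l2_has_sum_def)
  have eq: "l2_norm (\<lambda>t. (\<Sum>i\<in>F. v i t) - h t) = l2_norm (\<lambda>t. (\<Sum>i\<in>F. u i t) - h t)" if "finite F" for F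
  proof (rule l2_norm_cong_AE(2))
    show "(\<lambda>t. (\<Sum>i\<in>F. u i t) - h t) \<in> L2"
      by (intro L2_diff L2_sum L)
    show "(\<lambda>t. (\<Sum>i\<in>F. v i t) - h t) \<in> borel_measurable lborel"
      by (intro L2_measurable L2_diff L2_sum L assms)
    have "AE t in lborel. \<forall>i\<in>F. v i t = u i t"
      by (rule AE_finite_allI[OF that]) (rule assms(3))
    then show "AE t in lborel. (\<Sum>i\<in>F. u i t) - h t = (\<Sum>i\<in>F. v i t) - h t"
      by eventually_elim simp
  qed
  show ?thesis
    unfolding l2_has_sum_iff
  proof (intro conjI allI impI assms(2) L(1))
    fix e :: real assume "e > 0"
    then obtain A where A: "finite A"
      "\<And>F. finite F \<Longrightarrow> A \<subseteq> F \<Longrightarrow> l2_norm (\<lambda>t. (\<Sum>i\<in>F. u i t) - h t) < e"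
      using l2_has_sumD[OF assms(1), of e] by auto
    then show "\<exists>A. finite A \<and> (\<forall>F. finite F \<and> A \<subseteq> F \<longrightarrow> l2_norm (\<lambda>t. (\<Sum>i\<in>F. v i t) - h t) < e)"
      by (intro exI[of _ A]) (simp add: eq)
  qed
qed

lemma l2_has_sum_cmult:
  assumes "l2_has_sum u h"
  shows "l2_has_sum (\<lambda>i t. c * u i t) (\<lambda>t. c * h t)"
proof -
  have L: "h \<in> L2" "\<And>i. u i \<in> L2"
    using assms by (auto simp: l2_has_sum_def)
  have "l2_norm (\<lambda>t. (\<Sum>i\<in>F. c * u i t) - c * h t) = cmod c * l2_norm (\<lambda>t. (\<Sum>i\<in>F. u i t) - h t)" for F
    by (simp add: l2_norm_cmult flip: sum_distrib_left right_diff_distrib)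
  moreover have "((\<lambda>F. cmod c * l2_norm (\<lambda>t. (\<Sum>i\<in>F. u i t) - h t)) \<longlongrightarrow> 0) (finite_subsets_at_top UNIV)"
    using assms by (intro tendsto_mult_right_zero) (simp add: l2_has_sum_def)
  ultimately show ?thesis
    using L by (simp add: l2_has_sum_def L2_cmult)
qed

text \<open>A finite set of outer indices that covers the outer indices of \<open>A\<close> is
  completed to a rectangle that contains \<open>A\<close> and is large enough in each inner series.
  The rectangle is close to \<open>h\<close> by the first assumption and close to the sum of the
  \<open>w j\<close> by the second.\<close>

lemma l2_has_sum_Sigma:
  fixes u :: "'i \<times> 'j \<Rightarrow> real \<Rightarrow> complex"
  assumes u: "l2_has_sum u h" and w: "\<And>j. l2_has_sum (\<lambda>i. u (i, j)) (w j)"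
  shows "l2_has_sum w h"
  unfolding l2_has_sum_iff
proof (intro conjI allI impI)
  have L: "h \<in> L2" "\<And>p. u p \<in> L2" "\<And>j. w j \<in> L2"
    using assms by (auto simp: l2_has_sum_def)
  then show "w j \<in> L2" "h \<in> L2" for j by auto
  fix e :: real assume "e > 0"
  then obtain A where A: "finite A"
    "\<And>F. finite F \<Longrightarrow> A \<subseteq> F \<Longrightarrow> l2_norm (\<lambda>t. (\<Sum>p\<in>F. u p t) - h t) < e/2"
    using l2_has_sumD[OF u, of "e/2"] by auto
  show "\<exists>A. finite A \<and> (\<forall>F. finite F \<and> A \<subseteq> F \<longrightarrow> l2_norm (\<lambda>t. (\<Sum>j\<in>F. w j t) - h t) < e)"
  proof (intro exI[of _ "snd ` A"] conjI allI impI)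
    fix F assume F: "finite F \<and> snd ` A \<subseteq> F"
    \<comment> \<open>There are \<open>card F\<close> inner errors, which together may cost
      \<open>e/2\<close>; the added 1 covers an empty \<open>F\<close>.\<close>
    define d where "d = e / (2 * (real (card F) + 1))"
    have d: "d > 0" using \<open>e > 0\<close> by (simp add: d_def)
    have "\<exists>M. finite M \<and> (\<forall>G. finite G \<and> M \<subseteq> G \<longrightarrow> l2_norm (\<lambda>t. (\<Sum>i\<in>G. u (i, j) t) - w j t) < d)" for j
      using w[of j] d unfolding l2_has_sum_iff by simp
    then obtain M where M: "\<And>j. finite (M j)"
      "\<And>j G. finite G \<Longrightarrow> M j \<subseteq> G \<Longrightarrow> l2_norm (\<lambda>t. (\<Sum>i\<in>G. u (i, j) t) - w j t) < d"
      by metis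
    \<comment> \<open>One common \<open>G\<close> for all \<open>j\<close> makes the index set a
      product, so the sum over it splits into inner sums.\<close>
    define G where "G = fst ` A \<union> (\<Union>j\<in>F. M j)"
    have G: "finite G" "\<And>j. j \<in> F \<Longrightarrow> M j \<subseteq> G" "A \<subseteq> G \<times> F"
      using F A(1) M(1) by (auto simp: G_def image_iff) force+
    let ?s = "\<lambda>t. \<Sum>p\<in>G \<times> F. u p t"
    have s: "?s t = (\<Sum>j\<in>F. \<Sum>i\<in>G. u (i, j) t)" for t
      by (subst sum.swap) (simp add: sum.cartesian_product)
    have "l2_norm (\<lambda>t. (\<Sum>j\<in>F. w j t) - h t)
        \<le> l2_norm (\<lambda>t. (\<Sum>j\<in>F. w j t) - ?s t) + l2_norm (\<lambda>t. ?s t - h t)"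
      by (intro l2_norm_triangle_mid L L2_sum)
    also have "l2_norm (\<lambda>t. (\<Sum>j\<in>F. w j t) - ?s t) = l2_norm (\<lambda>t. ?s t - (\<Sum>j\<in>F. w j t))"
      by (rule l2_norm_minus_commute)
    also have "\<dots> = l2_norm (\<lambda>t. \<Sum>j\<in>F. (\<Sum>i\<in>G. u (i, j) t) - w j t)"
      unfolding s sum_subtractf ..
    also have "\<dots> \<le> (\<Sum>j\<in>F. l2_norm (\<lambda>t. (\<Sum>i\<in>G. u (i, j) t) - w j t))"
      by (intro l2_norm_sum_le L2_diff L2_sum L)
    also have "\<dots> \<le> (\<Sum>j\<in>F. d)"
      using M(2) G by (intro sum_mono less_imp_le) auto
    also have "\<dots> \<le> e/2"
      using \<open>e > 0\<close> by (simp add: d_def field_simps)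
    also have "l2_norm (\<lambda>t. ?s t - h t) < e/2"
      using A(2) G F by auto
    finally show "l2_norm (\<lambda>t. (\<Sum>j\<in>F. w j t) - h t) < e" by simp
  qed (use A in auto)
qed

text \<open>Completeness speaks about sequences, convergence here about the net of finite sets.
  Nested finite sets \<open>U n\<close>, beyond which every further finite sum is below
  \<open>(1/2)^n\<close>, give a Cauchy sequence whose limit is then the limit of the whole
  net.\<close>

lemma l2_summable_Cauchy:
  assumes u: "\<And>i. u i \<in> L2"
    and Cauchy: "\<And>e. e > 0 \<Longrightarrow> \<exists>A. finite A \<and> (\<forall>F. finite F \<and> F \<inter> A = {} \<longrightarrow> l2_norm (\<lambda>t. \<Sum>i\<in>F. u i t) < e)"
  shows "l2_summable u"
proof -
  have "\<exists>A. finite A \<and> (\<forall>F. finite F \<and> F \<inter> A = {} \<longrightarrow> l2_norm (\<lambda>t. \<Sum>i\<in>F. u i t) < (1/2)^n)" for n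
    by (rule Cauchy) simp
  then obtain A where A: "\<And>n. finite (A n)"
    "\<And>n F. finite F \<Longrightarrow> F \<inter> A n = {} \<Longrightarrow> l2_norm (\<lambda>t. \<Sum>i\<in>F. u i t) < (1/2)^n"
    by metis
  define U where "U n = (\<Union>k\<le>n. A k)" for n
  have U: "finite (U n)" "A n \<subseteq> U n" for n
    using A(1) by (auto simp: U_def)
  have U_mono: "U m \<subseteq> U n" if "m \<le> n" for m n
    unfolding U_def using that by (intro UN_mono) auto
  have diff: "l2_norm (\<lambda>t. (\<Sum>i\<in>F. u i t) - (\<Sum>i\<in>U n. u i t)) < (1/2)^n" if "finite F" "U n \<subseteq> F" for F n
  proof -
    have "(\<lambda>t. (\<Sum>i\<in>F. u i t) - (\<Sum>i\<in>U n. u i t)) = (\<lambda>t. \<Sum>i\<in>F - U n. u i t)"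
      using that by (simp add: sum_diff)
    then show ?thesis
      using A(2)[of "F - U n" n] that U(2) by auto
  qed
  have "\<exists>h\<in>L2. (\<lambda>n. l2_norm (\<lambda>x. (\<Sum>i\<in>U n. u i x) - h x)) \<longlonglongrightarrow> 0"
  proof (rule L2_complete)
    fix e :: real assume "e > 0"
    then obtain k where k: "(1/2::real)^k < e/2"
      using real_arch_pow_inv[of "e/2" "1/2"] by auto
    have "l2_norm (\<lambda>x. (\<Sum>i\<in>U m. u i x) - (\<Sum>i\<in>U n. u i x)) < e" if "m \<ge> k" "n \<ge> k" for m n
    proof -
      have "l2_norm (\<lambda>x. (\<Sum>i\<in>U m. u i x) - (\<Sum>i\<in>U n. u i x))
          \<le> l2_norm (\<lambda>x. (\<Sum>i\<in>U m. u i x) - (\<Sum>i\<in>U k. u i x)) + l2_norm (\<lambda>x. (\<Sum>i\<in>U k. u i x) - (\<Sum>i\<in>U n. u i x))"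
        by (intro l2_norm_triangle_mid L2_sum u)
      also have "\<dots> < (1/2)^k + (1/2)^k"
        using diff[OF U(1) U_mono] that by (subst (2) l2_norm_minus_commute) (intro add_strict_mono)
      finally show ?thesis using k by simp
    qed
    then show "\<exists>N. \<forall>m\<ge>N. \<forall>n\<ge>N. l2_norm (\<lambda>x. (\<Sum>i\<in>U m. u i x) - (\<Sum>i\<in>U n. u i x)) < e" by blast
  qed (intro L2_sum u)
  then obtain h where h: "h \<in> L2" "(\<lambda>n. l2_norm (\<lambda>x. (\<Sum>i\<in>U n. u i x) - h x)) \<longlonglongrightarrow> 0"
    by blast
  have "l2_has_sum u h"
    unfolding l2_has_sum_iff
  proof (intro conjI allI impI u h(1))
    fix e :: real assume "e > 0"
    then have "\<forall>\<^sub>F n in sequentially. l2_norm (\<lambda>x. (\<Sum>i\<in>U n. u i x) - h x) < e/2"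
      using h(2) by (intro order_tendstoD(2)) auto
    moreover have "\<forall>\<^sub>F n in sequentially. (1/2::real)^n < e/2"
      using \<open>e > 0\<close> by (intro order_tendstoD(2)[OF LIMSEQ_power_zero]) auto
    ultimately have "\<forall>\<^sub>F n in sequentially. l2_norm (\<lambda>x. (\<Sum>i\<in>U n. u i x) - h x) < e/2 \<and> (1/2::real)^n < e/2"
      by (rule eventually_conj)
    then obtain n where n: "l2_norm (\<lambda>x. (\<Sum>i\<in>U n. u i x) - h x) < e/2" "(1/2::real)^n < e/2"
      using eventually_happens'[OF sequentially_bot] by blast
    have "l2_norm (\<lambda>t. (\<Sum>i\<in>F. u i t) - h t) < e" if F: "finite F" "U n \<subseteq> F" for F
    proof -
      have "l2_norm (\<lambda>t. (\<Sum>i\<in>F. u i t) - h t)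
          \<le> l2_norm (\<lambda>t. (\<Sum>i\<in>F. u i t) - (\<Sum>i\<in>U n. u i t)) + l2_norm (\<lambda>x. (\<Sum>i\<in>U n. u i x) - h x)"
        by (intro l2_norm_triangle_mid L2_sum u h)
      then show ?thesis
        using diff[OF F] n by linarith
    qed
    then show "\<exists>A. finite A \<and> (\<forall>F. finite F \<and> A \<subseteq> F \<longrightarrow> l2_norm (\<lambda>t. (\<Sum>i\<in>F. u i t) - h t) < e)"
      using U(1) by blast
  qed
  then show ?thesis by (auto simp: l2_summable_def)
qed

text \<open>The adjoint of the analysis operator has the same bound.\<close>

lemma Bessel_synthesis_bound:
  assumes e: "\<And>i. i \<in> F \<Longrightarrow> e i \<in> L2" and "finite F" "0 \<le> B"
    and Bessel: "\<And>f. f \<in> L2 \<Longrightarrow> (\<Sum>i\<in>F. (cmod (l2_inner f (e i)))\<^sup>2) \<le> B * (l2_norm f)\<^sup>2"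
  shows "(l2_norm (\<lambda>t. \<Sum>i\<in>F. c i * e i t))\<^sup>2 \<le> B * (\<Sum>i\<in>F. (cmod (c i))\<^sup>2)"
proof -
  define h where "h = (\<lambda>t. \<Sum>i\<in>F. c i * e i t)"
  have h: "h \<in> L2"
    unfolding h_def by (intro L2_sum L2_cmult e)
  have "(l2_norm h)\<^sup>2 = cmod (l2_inner h h)"
    by (simp only: l2_inner_self norm_of_real) simp
  also have "l2_inner h h = (\<Sum>i\<in>F. c i * l2_inner (e i) h)"
    by (subst (1) h_def, subst l2_inner_sum_left) (auto simp: l2_inner_cmult_left intro: L2_cmult e h)
  also have "cmod \<dots> \<le> (\<Sum>i\<in>F. cmod (c i) * cmod (l2_inner h (e i)))"
    by (rule sum_norm_le) (simp add: norm_mult l2_inner_cnj[of _ h])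
  finally have 1: "(l2_norm h)\<^sup>2 \<le> (\<Sum>i\<in>F. cmod (c i) * cmod (l2_inner h (e i)))" .
  have "((l2_norm h)\<^sup>2)\<^sup>2 \<le> (\<Sum>i\<in>F. cmod (c i) * cmod (l2_inner h (e i)))\<^sup>2"
    by (intro power_mono 1) simp
  also have "\<dots> \<le> (\<Sum>i\<in>F. (cmod (c i))\<^sup>2) * (\<Sum>i\<in>F. (cmod (l2_inner h (e i)))\<^sup>2)"
    by (rule Cauchy_Schwarz_ineq_sum)
  also have "\<dots> \<le> (\<Sum>i\<in>F. (cmod (c i))\<^sup>2) * (B * (l2_norm h)\<^sup>2)"
    by (intro mult_left_mono Bessel h sum_nonneg) auto
  finally have 2: "(l2_norm h)\<^sup>2 * (l2_norm h)\<^sup>2 \<le> (B * (\<Sum>i\<in>F. (cmod (c i))\<^sup>2)) * (l2_norm h)\<^sup>2"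
    by (simp add: power2_eq_square algebra_simps)
  have "(l2_norm h)\<^sup>2 \<le> B * (\<Sum>i\<in>F. (cmod (c i))\<^sup>2)"
  \<comment> \<open>One factor of the squared norm cancels from both sides of \<open>2\<close>
    unless it is zero.\<close>
  proof (cases "(l2_norm h)\<^sup>2 = 0")
    case True
    show ?thesis unfolding True using \<open>0 \<le> B\<close> by (intro mult_nonneg_nonneg sum_nonneg) auto
  next
    case False
    then show ?thesis by (intro mult_right_le_imp_le[OF 2]) simp
  qed
  then show ?thesis by (simp add: h_def)
qed

text \<open>The squared coefficients are summable, so their sums over finite sets away from a
  suitable \<open>A\<close> are small; the synthesis bound turns this into small norms, which is the
  Cauchy criterion.\<close>

lemma Bessel_summable:
  fixes e :: "'i \<Rightarrow> real \<Rightarrow> complex"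
  assumes e: "\<And>i. e i \<in> L2" and "0 \<le> B" and f: "f \<in> L2"
    and Bessel: "\<And>f F. f \<in> L2 \<Longrightarrow> finite F \<Longrightarrow> (\<Sum>i\<in>F. (cmod (l2_inner f (e i)))\<^sup>2) \<le> B * (l2_norm f)\<^sup>2"
  shows "l2_summable (\<lambda>i t. l2_inner f (e i) * e i t)"
proof (rule l2_summable_Cauchy)
  fix \<epsilon> :: real assume "\<epsilon> > 0"
  define c where "c i = (cmod (l2_inner f (e i)))\<^sup>2" for i
  have "c summable_on UNIV"
  proof (rule nonneg_bdd_above_summable_on)
    show "bdd_above (sum c ` {F. F \<subseteq> UNIV \<and> finite F})"
      unfolding c_def using Bessel[OF f] by (auto intro!: bdd_aboveI[of _ "B * (l2_norm f)\<^sup>2"])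
  qed (simp add: c_def)
  \<comment> \<open>The added 1 keeps the denominator positive when \<open>B = 0\<close>.\<close>
  moreover define d where "d = \<epsilon>\<^sup>2 / (B + 1)"
  moreover have "d > 0"
    unfolding d_def using \<open>\<epsilon> > 0\<close> \<open>0 \<le> B\<close> by (intro divide_pos_pos) auto
  ultimately obtain A where A: "finite A" "\<And>F. finite F \<Longrightarrow> A \<subseteq> F \<Longrightarrow> dist (sum c F) (infsum c UNIV) < d / 2"
    using infsum_tendsto[of c UNIV] unfolding tendsto_iff eventually_finite_subsets_at_top
    by (metis half_gt_zero subset_UNIV)
  have "l2_norm (\<lambda>t. \<Sum>i\<in>F. l2_inner f (e i) * e i t) < \<epsilon>" if F: "finite F" "F \<inter> A = {}" for F
  proof -
    have "(l2_norm (\<lambda>t. \<Sum>i\<in>F. l2_inner f (e i) * e i t))\<^sup>2 \<le> B * sum c F"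
      unfolding c_def by (intro Bessel_synthesis_bound e F Bessel \<open>0 \<le> B\<close>)
    also have "\<dots> \<le> (B + 1) * sum c F"
      by (intro mult_right_mono sum_nonneg) (auto simp: c_def)
    also have "\<dots> < (B + 1) * d"
    proof (rule mult_strict_left_mono)
      \<comment> \<open>For \<open>F\<close> disjoint from \<open>A\<close> the sum over
        \<open>F\<close> is a difference of two partial sums, each within \<open>d / 2\<close> of
        the limit.\<close>
      have "\<bar>sum c (A \<union> F) - infsum c UNIV\<bar> < d / 2" "\<bar>sum c A - infsum c UNIV\<bar> < d / 2"
        using A(2)[of "A \<union> F"] A(2)[of A] A(1) F(1) unfolding dist_real_def by simp_all
      moreover have "sum c F = sum c (A \<union> F) - sum c A"
        using F A(1) by (subst sum.union_disjoint) auto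
      ultimately show "sum c F < d" by linarith
    qed (use \<open>0 \<le> B\<close> in simp)
    also have "\<dots> = \<epsilon>\<^sup>2"
      using \<open>0 \<le> B\<close> by (simp add: d_def)
    finally have "(l2_norm (\<lambda>t. \<Sum>i\<in>F. l2_inner f (e i) * e i t))\<^sup>2 < \<epsilon>\<^sup>2" .
    then show ?thesis
      using \<open>\<epsilon> > 0\<close> by (simp add: power2_less_imp_less)
  qed
  then show "\<exists>A. finite A \<and> (\<forall>F. finite F \<and> F \<inter> A = {} \<longrightarrow> l2_norm (\<lambda>t. \<Sum>i\<in>F. l2_inner f (e i) * e i t) < \<epsilon>)"
    using A(1) by blast
qed (intro L2_cmult e)

section \<open>Periodization\<close>

text \<open>Summable and absolutely summable agree for complex families, and both sides default to 0
  otherwise, so the identity is unconditional. It makes Fubini, Cauchy-Schwarz and measurability of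
  parameter integrals available for brackets.\<close>

lemma infsum_eq_integral_count_space:
  fixes f :: "'i \<Rightarrow> complex"
  shows "infsum f UNIV = (LINT i|count_space UNIV. f i)"
proof (cases "f summable_on UNIV")
  case True
  then have "Infinite_Set_Sum.abs_summable_on f UNIV"
    by (simp add: summable_on_iff_abs_summable_on_complex flip: abs_summable_equivalent)
  then show ?thesis
    by (simp add: infsetsum_infsum[symmetric] infsetsum_def)
next
  case False
  then have "\<not> integrable (count_space UNIV) f"
    by (simp add: summable_on_iff_abs_summable_on_complex abs_summable_equivalent abs_summable_on_def)
  then show ?thesis
    using False by (simp add: infsum_not_exists not_integrable_integral_eq)
qed

lemma sigma_finite_count_space_int: "sigma_finite_measure (count_space (UNIV :: int set))"
  by (rule sigma_finite_measure_count_space_countable) simp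

interpretation int_lborel: pair_sigma_finite "count_space (UNIV :: int set)" "lborel :: real measure"
  by (intro pair_sigma_finite.intro sigma_finite_count_space_int lborel.sigma_finite_measure_axioms)

lemma measurable_int_lborel:
  fixes f :: "int \<Rightarrow> real \<Rightarrow> 'b::topological_space"
  assumes "\<And>k. f k \<in> borel_measurable borel"
  shows "case_prod f \<in> borel_measurable (count_space UNIV \<Otimes>\<^sub>M lborel)"
  by (rule measurable_pair_measure_countable1) (use assms in auto)

lemma measurable_lborel_int:
  fixes f :: "real \<Rightarrow> int \<Rightarrow> 'b::topological_space"
  assumes "\<And>k. (\<lambda>t. f t k) \<in> borel_measurable borel"
  shows "case_prod f \<in> borel_measurable (lborel \<Otimes>\<^sub>M count_space UNIV)"
proof -
  have "(\<lambda>(k, t). f t k) \<in> borel_measurable (count_space UNIV \<Otimes>\<^sub>M lborel)"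
    by (rule measurable_int_lborel) (rule assms)
  from measurable_compose[OF measurable_pair_swap' this]
  show ?thesis by (simp add: case_prod_beta')
qed

text \<open>The half-open period tiles the line, so exactly one shift moves \<open>t\<close> into
  it; a closed period would give two shifts at the end points.\<close>

lemma shift_in_period:
  fixes P t :: real
  assumes "P > 0"
  shows "indicator {0..<P} (t + of_int k * P) = (indicator {- \<lfloor>t / P\<rfloor>} k :: 'a::zero_neq_one)"
proof -
  have "0 \<le> t + of_int k * P \<and> t + of_int k * P < P \<longleftrightarrow> of_int (-k) \<le> t / P \<and> t / P < of_int (-k) + 1"
    using assms by (auto simp: field_simps)
  also have "\<dots> \<longleftrightarrow> \<lfloor>t / P\<rfloor> = - k"
    by (simp only: floor_eq_iff)
  finally show ?thesis
    by (auto simp: indicator_def)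
qed

lemma nn_integral_translate:
  fixes u :: "real \<Rightarrow> ennreal"
  assumes "u \<in> borel_measurable borel"
  shows "(\<integral>\<^sup>+t. u (t - s) \<partial>lborel) = (\<integral>\<^sup>+t. u t \<partial>lborel)"
  using nn_integral_real_affine[OF assms, of 1 "-s"] by simp

text \<open>The indicators of the shifted periods sum to 1. Inserting them, exchanging sum and
  integral, translating each piece back to the base period and exchanging again gives the folded
  form.\<close>

lemma nn_integral_periodize:
  fixes u :: "real \<Rightarrow> ennreal"
  assumes "P > 0" and [measurable]: "u \<in> borel_measurable borel"
  shows "(\<integral>\<^sup>+t. u t \<partial>lborel)
    = (\<integral>\<^sup>+t. indicator {0..<P} t * (\<integral>\<^sup>+k. u (t - of_int k * P) \<partial>count_space (UNIV :: int set)) \<partial>lborel)"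
proof -
  let ?Z = "count_space (UNIV :: int set)"
  have 1: "case_prod (\<lambda>k t. indicator {0..<P} (t + of_int k * P) * u t) \<in> borel_measurable (?Z \<Otimes>\<^sub>M lborel)"
    by (rule measurable_int_lborel) measurable
  have 2: "case_prod (\<lambda>k t. indicator {0..<P} t * u (t - of_int k * P)) \<in> borel_measurable (?Z \<Otimes>\<^sub>M lborel)"
    by (rule measurable_int_lborel) measurable
  have "(\<integral>\<^sup>+t. u t \<partial>lborel) = (\<integral>\<^sup>+t. (\<integral>\<^sup>+k. indicator {0..<P} (t + of_int k * P) * u t \<partial>?Z) \<partial>lborel)"
    unfolding shift_in_period[OF \<open>P > 0\<close>] by (subst nn_integral_multc) auto
  also have "\<dots> = (\<integral>\<^sup>+k. (\<integral>\<^sup>+t. indicator {0..<P} (t + of_int k * P) * u t \<partial>lborel) \<partial>?Z)"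
    using int_lborel.Fubini'[OF 1] by simp
  also have "\<dots> = (\<integral>\<^sup>+k. (\<integral>\<^sup>+t. indicator {0..<P} t * u (t - of_int k * P) \<partial>lborel) \<partial>?Z)"
  proof (rule nn_integral_cong)
    fix k :: int
    have "(\<lambda>t. indicator {0..<P} (t + of_int k * P) * u t) \<in> borel_measurable borel"
      by measurable
    from nn_integral_translate[OF this, of "of_int k * P"]
    show "(\<integral>\<^sup>+t. indicator {0..<P} (t + of_int k * P) * u t \<partial>lborel)
        = (\<integral>\<^sup>+t. indicator {0..<P} t * u (t - of_int k * P) \<partial>lborel)"
      by simp
  qed
  also have "\<dots> = (\<integral>\<^sup>+t. (\<integral>\<^sup>+k. indicator {0..<P} t * u (t - of_int k * P) \<partial>?Z) \<partial>lborel)"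
    using int_lborel.Fubini'[OF 2] by simp
  also have "\<dots> = (\<integral>\<^sup>+t. indicator {0..<P} t * (\<integral>\<^sup>+k. u (t - of_int k * P) \<partial>?Z) \<partial>lborel)"
    by (subst nn_integral_cmult) auto
  finally show ?thesis .
qed

text \<open>Folding the indicator of the exceptional set gives 0, because by periodicity no shift of
  a good point of the base period is bad.\<close>

lemma AE_periodic:
  fixes P :: real
  assumes "P > 0" and [measurable]: "Measurable.pred borel Q"
    and per: "\<And>t (k::int). Q (t - of_int k * P) = Q t"
    and AE: "AE t in lborel. t \<in> {0..<P} \<longrightarrow> Q t"
  shows "AE t in lborel. Q t"
proof -
  have "(\<integral>\<^sup>+t. indicator {t. \<not> Q t} t \<partial>lborel)
      = (\<integral>\<^sup>+t. indicator {0..<P} t * (\<integral>\<^sup>+k. indicator {t. \<not> Q t} (t - of_int k * P) \<partial>count_space (UNIV :: int set)) \<partial>lborel)"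
    by (rule nn_integral_periodize[OF \<open>P > 0\<close>]) measurable
  also have "\<dots> = (\<integral>\<^sup>+t. 0 \<partial>(lborel :: real measure))"
    using AE by (intro nn_integral_cong_AE, eventually_elim) (auto simp: indicator_def per)
  finally have "emeasure lborel {t. \<not> Q t} = 0"
    by simp
  then show ?thesis
    by (intro AE_I[where N="{t. \<not> Q t}"]) auto
qed

lemma bij_int_shift: "bij (\<lambda>k::int. k + j)"
  by (rule bij_betw_byWitness[where f'="\<lambda>k. k - j"]) auto

lemma integrable_int_shift:
  fixes u :: "int \<Rightarrow> 'a::{banach, second_countable_topology}"
  shows "integrable (count_space UNIV) (\<lambda>k. u (k + j)) \<longleftrightarrow> integrable (count_space UNIV) u"
  by (rule integrable_bij_count_space[OF bij_int_shift])

lemma integral_int_shift: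
  fixes u :: "int \<Rightarrow> 'a::{banach, second_countable_topology}"
  shows "(LINT k|count_space UNIV. u (k + j)) = (LINT k|count_space UNIV. u k)"
  by (rule integral_bij_count_space[OF bij_int_shift])

lemma integral_periodize:
  fixes u :: "real \<Rightarrow> 'a::{banach, second_countable_topology}"
  assumes "P > 0" and u: "integrable lborel u"
  shows "AE t in lborel. integrable (count_space (UNIV :: int set)) (\<lambda>k. u (t - of_int k * P))"
    and "integrable lborel (\<lambda>t. indicator {0..<P} t *\<^sub>R (LINT k|count_space (UNIV :: int set). u (t - of_int k * P)))"
    and "(LINT t|lborel. u t)
      = (LINT t|lborel. indicator {0..<P} t *\<^sub>R (LINT k|count_space (UNIV :: int set). u (t - of_int k * P)))"
proof -
  let ?Z = "count_space (UNIV :: int set)"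
  have [measurable]: "u \<in> borel_measurable borel"
    using u by auto
  have mZ: "(\<lambda>t. \<integral>\<^sup>+k. ennreal (norm (u (t - of_int k * P))) \<partial>?Z) \<in> borel_measurable lborel"
    by (rule sigma_finite_measure.borel_measurable_nn_integral[OF sigma_finite_count_space_int], rule measurable_lborel_int) measurable
  \<comment> \<open>\<open>?w\<close> cuts \<open>u\<close> into its pieces on the shifted periods,
    \<open>?v\<close> moves every piece to the base period. For each \<open>k\<close> they differ by
    a translation only, and both are integrable on the product, so Fubini applies on either
    side.\<close>
  let ?v = "\<lambda>k t. indicator {0..<P} t *\<^sub>R u (t - of_int k * P)"
  let ?w = "\<lambda>k t. indicator {0..<P} (t + of_int k * P) *\<^sub>R u t"
  have vm: "case_prod ?v \<in> borel_measurable (?Z \<Otimes>\<^sub>M lborel)" and wm: "case_prod ?w \<in> borel_measurable (?Z \<Otimes>\<^sub>M lborel)"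
    by (rule measurable_int_lborel, measurable)+
  have fin: "(\<integral>\<^sup>+t. ennreal (norm (u t)) \<partial>lborel) < \<infinity>"
    using u by (simp add: integrable_iff_bounded)
  have w: "integrable (?Z \<Otimes>\<^sub>M lborel) (case_prod ?w)"
  proof (rule integrableI_bounded[OF wm])
    have "(\<integral>\<^sup>+x. ennreal (norm (case_prod ?w x)) \<partial>(?Z \<Otimes>\<^sub>M lborel))
        = (\<integral>\<^sup>+t. (\<integral>\<^sup>+k. ennreal (norm (?w k t)) \<partial>?Z) \<partial>lborel)"
      by (subst int_lborel.nn_integral_snd[symmetric]) (use wm in auto)
    also have "\<dots> = (\<integral>\<^sup>+t. (\<integral>\<^sup>+k. indicator {- \<lfloor>t / P\<rfloor>} k * ennreal (norm (u t)) \<partial>?Z) \<partial>lborel)"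
      unfolding shift_in_period[OF \<open>P > 0\<close>] by (intro nn_integral_cong) (simp split: split_indicator)
    also have "\<dots> = (\<integral>\<^sup>+t. ennreal (norm (u t)) \<partial>lborel)"
      by (subst nn_integral_multc) auto
    finally show "(\<integral>\<^sup>+x. ennreal (norm (case_prod ?w x)) \<partial>(?Z \<Otimes>\<^sub>M lborel)) < \<infinity>"
      using fin by simp
  qed
  have v: "integrable (?Z \<Otimes>\<^sub>M lborel) (case_prod ?v)"
  proof (rule integrableI_bounded[OF vm])
    have "(\<integral>\<^sup>+x. ennreal (norm (case_prod ?v x)) \<partial>(?Z \<Otimes>\<^sub>M lborel))
        = (\<integral>\<^sup>+t. (\<integral>\<^sup>+k. ennreal (norm (?v k t)) \<partial>?Z) \<partial>lborel)"
      by (subst int_lborel.nn_integral_snd[symmetric]) (use vm in auto)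
    also have "\<dots> = (\<integral>\<^sup>+t. indicator {0..<P} t * (\<integral>\<^sup>+k. ennreal (norm (u (t - of_int k * P))) \<partial>?Z) \<partial>lborel)"
      by (intro nn_integral_cong) (simp split: split_indicator)
    also have "\<dots> = (\<integral>\<^sup>+t. ennreal (norm (u t)) \<partial>lborel)"
      by (rule nn_integral_periodize[OF \<open>P > 0\<close>, symmetric]) measurable
    finally show "(\<integral>\<^sup>+x. ennreal (norm (case_prod ?v x)) \<partial>(?Z \<Otimes>\<^sub>M lborel)) < \<infinity>"
      using fin by simp
  qed
  have inner: "(LINT k|?Z. ?v k t) = indicator {0..<P} t *\<^sub>R (LINT k|?Z. u (t - of_int k * P))" for t
    by (simp split: split_indicator)
  show "integrable lborel (\<lambda>t. indicator {0..<P} t *\<^sub>R (LINT k|?Z. u (t - of_int k * P)))"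
    using int_lborel.integrable_snd[OF v] by (simp only: inner)
  show "AE t in lborel. integrable ?Z (\<lambda>k. u (t - of_int k * P))"
  proof (rule AE_periodic[OF \<open>P > 0\<close>])
    have "integrable ?Z (\<lambda>k. u (t - of_int k * P)) \<longleftrightarrow> (\<integral>\<^sup>+k. ennreal (norm (u (t - of_int k * P))) \<partial>?Z) < \<infinity>" for t
      by (simp add: integrable_iff_bounded)
    then show "Measurable.pred borel (\<lambda>t. integrable ?Z (\<lambda>k. u (t - of_int k * P)))"
      using mZ by simp
    show "integrable ?Z (\<lambda>k. u (t - of_int j * P - of_int k * P)) = integrable ?Z (\<lambda>k. u (t - of_int k * P))" for t j
      using integrable_int_shift[of "\<lambda>k. u (t - of_int k * P)" j] by (simp add: algebra_simps)
    show "AE t in lborel. t \<in> {0..<P} \<longrightarrow> integrable ?Z (\<lambda>k. u (t - of_int k * P))"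
      using int_lborel.AE_integrable_snd[OF v] by eventually_elim (auto simp: indicator_def)
  qed
  have "(LINT t|lborel. u t) = (LINT t|lborel. (LINT k|?Z. ?w k t))"
  proof (rule Bochner_Integration.integral_cong[OF refl])
    fix t
    have "(LINT k|?Z. ?w k t) = (LINT k|?Z. indicator {- \<lfloor>t / P\<rfloor>} k *\<^sub>R u t)"
      unfolding shift_in_period[OF \<open>P > 0\<close>] ..
    also have "\<dots> = u t"
      by (subst has_bochner_integral_integral_eq[OF has_bochner_integral_indicator]) auto
    finally show "u t = (LINT k|?Z. ?w k t)" ..
  qed
  also have "\<dots> = (LINT k|?Z. (LINT t|lborel. ?w k t))"
    by (rule int_lborel.Fubini_integral[OF w])
  also have "\<dots> = (LINT k|?Z. (LINT t|lborel. ?v k t))"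
  proof (rule Bochner_Integration.integral_cong[OF refl])
    fix k :: int
    show "(LINT t|lborel. ?w k t) = (LINT t|lborel. ?v k t)"
      using lborel_integral_real_affine[of 1 "\<lambda>t. ?w k t" "- of_int k * P"] by simp
  qed
  also have "\<dots> = (LINT t|lborel. (LINT k|?Z. ?v k t))"
    by (rule int_lborel.Fubini_integral[OF v, symmetric])
  finally show "(LINT t|lborel. u t) = (LINT t|lborel. indicator {0..<P} t *\<^sub>R (LINT k|?Z. u (t - of_int k * P)))"
    unfolding inner .
qed

section \<open>The bracket product\<close>

text \<open>The square of \<open>bracket_norm P f\<close>, kept real-valued and free of the square
  root. For a window \<open>h\<close> and \<open>P = 1/b\<close> this is the weight w.\<close>

definition period_sq :: "real \<Rightarrow> (real \<Rightarrow> complex) \<Rightarrow> real \<Rightarrow> real" where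
  "period_sq P f t = (LINT k|count_space (UNIV :: int set). (cmod (f (t - of_int k * P)))\<^sup>2)"

lemma period_sq_nonneg [simp]: "0 \<le> period_sq P f t"
  unfolding period_sq_def by (rule Bochner_Integration.integral_nonneg) simp

lemma bracket_eq_integral:
  "bracket P f h t = (LINT k|count_space (UNIV :: int set). f (t - of_int k * P) * cnj (h (t - of_int k * P)))"
  unfolding bracket_def by (rule infsum_eq_integral_count_space)

lemma bracket_self: "bracket P f f t = of_real (period_sq P f t)"
  unfolding bracket_eq_integral period_sq_def
  by (simp flip: complex_norm_square integral_complex_of_real)

lemma borel_measurable_bracket:
  assumes [measurable]: "f \<in> borel_measurable borel" "h \<in> borel_measurable borel"
  shows "bracket P f h \<in> borel_measurable borel"
proof -
  have "bracket P f h \<in> borel_measurable lborel"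
    unfolding bracket_eq_integral[abs_def]
    by (rule sigma_finite_measure.borel_measurable_lebesgue_integral[OF sigma_finite_count_space_int], rule measurable_lborel_int) measurable
  then show ?thesis by simp
qed

lemma borel_measurable_period_sq:
  assumes [measurable]: "f \<in> borel_measurable borel"
  shows "period_sq P f \<in> borel_measurable borel"
proof -
  have "period_sq P f = (\<lambda>t. Re (bracket P f f t))"
    by (simp add: bracket_self)
  then show ?thesis
    using borel_measurable_bracket[OF assms assms] by simp
qed

lemma bracket_periodic: "bracket P f h (t - of_int j * P) = bracket P f h t"
  unfolding bracket_eq_integral
  using integral_int_shift[of "\<lambda>k. f (t - of_int k * P) * cnj (h (t - of_int k * P))" j]
  by (simp add: algebra_simps)

lemma period_sq_periodic: "period_sq P f (t - of_int j * P) = period_sq P f t"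
  using bracket_periodic[of P f f t j] unfolding bracket_self of_real_eq_iff .

lemma AE_integrable_period_sq:
  assumes "P > 0" "f \<in> L2"
  shows "AE t in lborel. integrable (count_space (UNIV :: int set)) (\<lambda>k. (cmod (f (t - of_int k * P)))\<^sup>2)"
  by (rule integral_periodize(1)[OF \<open>P > 0\<close> L2_integrable[OF \<open>f \<in> L2\<close>]])

text \<open>For almost every \<open>t\<close> the samples of \<open>f\<close> and \<open>h\<close>
  along the translates of \<open>t\<close> are square-summable, and the inequality is that of
  sequences over the integers.\<close>

lemma bracket_Cauchy_Schwarz:
  assumes "P > 0" "f \<in> L2" "h \<in> L2"
  shows "AE t in lborel. (cmod (bracket P f h t))\<^sup>2 \<le> period_sq P f t * period_sq P h t"
  using AE_integrable_period_sq[OF assms(1,2)] AE_integrable_period_sq[OF assms(1,3)]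
  unfolding bracket_eq_integral period_sq_def
  by eventually_elim (rule Cauchy_Schwarz_integral(2), auto)

text \<open>A factor of period \<open>P\<close> is constant along the translates of \<open>t\<close>
  and leaves the folded sum. The norm of \<open>\<phi> * f\<close> is thus the norm of
  \<open>\<phi>\<close> over one period with weight \<open>period_sq P f\<close>; the estimates for
  periodic multipliers rest on this.\<close>

lemma nn_integral_periodic_mult:
  assumes "P > 0" "f \<in> L2" and [measurable]: "\<phi> \<in> borel_measurable borel"
    and per: "\<And>t (k::int). \<phi> (t - of_int k * P) = \<phi> t"
  shows "(\<integral>\<^sup>+t. ennreal ((cmod (\<phi> t * f t))\<^sup>2) \<partial>lborel)
    = (\<integral>\<^sup>+t. ennreal (indicator {0..<P} t * ((cmod (\<phi> t))\<^sup>2 * period_sq P f t)) \<partial>lborel)"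
proof -
  let ?Z = "count_space (UNIV :: int set)"
  have [measurable]: "f \<in> borel_measurable borel"
    using L2_measurable[OF assms(2)] by simp
  have "(\<integral>\<^sup>+t. ennreal ((cmod (\<phi> t * f t))\<^sup>2) \<partial>lborel)
      = (\<integral>\<^sup>+t. indicator {0..<P} t * (\<integral>\<^sup>+k. ennreal ((cmod (\<phi> (t - of_int k * P) * f (t - of_int k * P)))\<^sup>2) \<partial>?Z) \<partial>lborel)"
    by (rule nn_integral_periodize[OF \<open>P > 0\<close>]) measurable
  also have "\<dots> = (\<integral>\<^sup>+t. ennreal (indicator {0..<P} t * ((cmod (\<phi> t))\<^sup>2 * period_sq P f t)) \<partial>lborel)"
    using AE_integrable_period_sq[OF assms(1,2)]
  proof (intro nn_integral_cong_AE, eventually_elim)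
    case (elim t)
    have "(\<integral>\<^sup>+k. ennreal ((cmod (\<phi> (t - of_int k * P) * f (t - of_int k * P)))\<^sup>2) \<partial>?Z)
        = (\<integral>\<^sup>+k. ennreal ((cmod (\<phi> t))\<^sup>2) * ennreal ((cmod (f (t - of_int k * P)))\<^sup>2) \<partial>?Z)"
      by (simp add: per norm_mult power_mult_distrib ennreal_mult')
    also have "\<dots> = ennreal ((cmod (\<phi> t))\<^sup>2) * ennreal (period_sq P f t)"
      by (subst nn_integral_cmult) (auto simp: period_sq_def nn_integral_eq_integral elim)
    finally show ?case
      by (simp add: ennreal_mult' split: split_indicator)
  qed
  finally show ?thesis .
qed

lemma l2_inner_periodic_mult:
  assumes "P > 0" "f \<in> L2" "(\<lambda>t. \<phi> t * h t) \<in> L2"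
    and per: "\<And>t (k::int). \<phi> (t - of_int k * P) = \<phi> t"
  shows "l2_inner f (\<lambda>t. \<phi> t * h t) = (LINT t|lborel. indicator {0..<P} t * (bracket P f h t * cnj (\<phi> t)))"
proof -
  have "integrable lborel (\<lambda>t. f t * cnj (\<phi> t * h t))"
    by (rule l2_inner_integrable) (rule assms)+
  from integral_periodize(3)[OF \<open>P > 0\<close> this]
  have "l2_inner f (\<lambda>t. \<phi> t * h t)
    = (LINT t|lborel. indicator {0..<P} t *\<^sub>R (LINT k|count_space (UNIV :: int set).
        f (t - of_int k * P) * cnj (\<phi> (t - of_int k * P) * h (t - of_int k * P))))"
    unfolding l2_inner_def .
  also have "\<dots> = (LINT t|lborel. indicator {0..<P} t * (bracket P f h t * cnj (\<phi> t)))"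
  proof (rule Bochner_Integration.integral_cong[OF refl])
    fix t
    have "(LINT k|count_space (UNIV :: int set). f (t - of_int k * P) * cnj (\<phi> (t - of_int k * P) * h (t - of_int k * P)))
        = (LINT k|count_space (UNIV :: int set). f (t - of_int k * P) * cnj (h (t - of_int k * P)) * cnj (\<phi> t))"
      unfolding per by (simp only: complex_cnj_mult mult_ac)
    also have "\<dots> = bracket P f h t * cnj (\<phi> t)"
      unfolding bracket_eq_integral by (rule integral_mult_left_zero)
    finally show "indicator {0..<P} t *\<^sub>R (LINT k|count_space (UNIV :: int set).
        f (t - of_int k * P) * cnj (\<phi> (t - of_int k * P) * h (t - of_int k * P)))
      = indicator {0..<P} t * (bracket P f h t * cnj (\<phi> t))"
      by (simp split: split_indicator)
  qed
  finally show ?thesis .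
qed

section \<open>Trigonometric approximation\<close>

text \<open>The exponent has the exact shape produced by \<open>modulation (of_int m * b)\<close>,
  so that Weyl-Heisenberg atoms unfold to it directly.\<close>

definition char_fun :: "real \<Rightarrow> int \<Rightarrow> real \<Rightarrow> complex" where
  "char_fun b m t = exp (2 * of_real pi * \<i> * of_real (of_int m * b) * of_real t)"

lemma char_fun_cis: "char_fun b m t = cis (2 * pi * (of_int m * b) * t)"
  by (simp add: char_fun_def cis_conv_exp mult_ac)

lemma cmod_char_fun [simp]: "cmod (char_fun b m t) = 1"
  by (simp add: char_fun_cis)

lemma continuous_on_char_fun [continuous_intros]: "continuous_on S (char_fun b m)"
  unfolding char_fun_def[abs_def] by (intro continuous_intros)

lemma borel_measurable_char_fun [measurable]: "char_fun b m \<in> borel_measurable borel"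
  by (intro borel_measurable_continuous_onI continuous_intros)

lemma char_fun_mult: "char_fun b m t * char_fun b n t = char_fun b (m + n) t"
  by (simp add: char_fun_cis cis_mult algebra_simps)

lemma char_fun_cnj: "cnj (char_fun b m t) = char_fun b (-m) t"
  by (simp add: char_fun_cis cis_cnj)

lemma char_fun_0 [simp]: "char_fun b 0 t = 1"
  by (simp add: char_fun_cis)

lemma char_fun_periodic:
  assumes "b > 0"
  shows "char_fun b m (t - of_int k * (1 / b)) = char_fun b m t"
proof -
  have "2 * pi * (of_int m * b) * (t - of_int k * (1 / b)) = 2 * pi * (of_int m * b) * t + 2 * pi * of_int (- (m * k))"
    using assms by (simp add: field_simps)
  then show ?thesis
    unfolding char_fun_cis by (simp only: cis_mult[symmetric] cis_multiple_2pi[OF Ints_of_int] mult_1_right)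
qed

lemma integral_char_fun:
  assumes "b > 0"
  shows "(LINT t|lborel. indicator {0..<1/b} t * char_fun b m t) = (if m = 0 then of_real (1 / b) else 0)"
proof -
  have "(LINT t|lborel. indicator {0..<1/b} t * char_fun b m t) = (LINT t|lborel. indicator {0..1/b} t *\<^sub>R char_fun b m t)"
  proof (rule integral_cong_AE)
    show "AE t in lborel. indicator {0..<1/b} t * char_fun b m t = indicator {0..1/b} t *\<^sub>R char_fun b m t"
      using AE_lborel_singleton[of "1/b"] by eventually_elim (auto split: split_indicator)
  qed measurable
  also have "\<dots> = (if m = 0 then of_real (1 / b) else 0)"
  proof (cases "m = 0")
    case True
    then show ?thesis using assms by (simp add: scaleR_conv_of_real)
  next
    case False
    define w where "w = 2 * of_real pi * \<i> * complex_of_real (of_int m * b)"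
    have w: "w \<noteq> 0" using False assms by (simp add: w_def)
    have eq: "char_fun b m t = exp (w * of_real t)" for t
      by (simp add: char_fun_def w_def)
    have "(LINT t|lborel. indicator {0..1/b} t *\<^sub>R char_fun b m t) = exp (w * of_real (1/b)) / w - exp (w * of_real 0) / w"
    proof (rule integral_FTC_atLeastAtMost)
      fix t :: real
      have "((\<lambda>z. exp (w * z) / w) has_field_derivative exp (w * of_real t)) (at (of_real t))"
        using w by (auto intro!: derivative_eq_intros)
      from has_vector_derivative_real_field[OF this]
      show "((\<lambda>t. exp (w * of_real t) / w) has_vector_derivative char_fun b m t) (at t within {0..1/b})"
        unfolding eq .
    qed (use assms in \<open>auto intro: continuous_intros\<close>)
    \<comment> \<open>The right end point is 0 shifted by one period, so periodicity makes the two
      boundary terms cancel.\<close>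
    also have "exp (w * of_real (1/b)) = char_fun b m (0 - of_int (- 1) * (1 / b))"
      unfolding eq by simp
    also have "\<dots> = exp (w * of_real 0)"
      unfolding char_fun_periodic[OF assms] eq ..
    finally show ?thesis using False by simp
  qed
  finally show ?thesis .
qed

section \<open>Trigonometric polynomials and uniform approximation\<close>

definition trig_poly :: "real \<Rightarrow> (real \<Rightarrow> complex) \<Rightarrow> bool" where
  "trig_poly b f \<longleftrightarrow> (\<exists>F c. finite F \<and> f = (\<lambda>t. \<Sum>m\<in>F. c m * char_fun b m t))"

lemma trig_poly_single: "trig_poly b (\<lambda>t. c * char_fun b m t)"
  unfolding trig_poly_def by (intro exI[of _ "{m}"] exI[of _ "\<lambda>_. c"]) simp

lemma trig_poly_const: "trig_poly b (\<lambda>t. c)"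
  using trig_poly_single[of b c 0] by simp

lemma trig_poly_add:
  assumes "trig_poly b f" "trig_poly b g"
  shows "trig_poly b (\<lambda>t. f t + g t)"
proof -
  obtain F c where F: "finite F" "f = (\<lambda>t. \<Sum>m\<in>F. c m * char_fun b m t)"
    using assms(1) unfolding trig_poly_def by blast
  obtain G d where G: "finite G" "g = (\<lambda>t. \<Sum>m\<in>G. d m * char_fun b m t)"
    using assms(2) unfolding trig_poly_def by blast
  define c' where "c' m = (if m \<in> F then c m else 0)" for m
  define d' where "d' m = (if m \<in> G then d m else 0)" for m
  have "f t + g t = (\<Sum>m\<in>F \<union> G. (c' m + d' m) * char_fun b m t)" for t
  proof -
    have "f t = (\<Sum>m\<in>F \<union> G. c' m * char_fun b m t)"
      unfolding F(2) c'_def using F(1) G(1) by (intro sum.mono_neutral_cong_left) auto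
    moreover have "g t = (\<Sum>m\<in>F \<union> G. d' m * char_fun b m t)"
      unfolding G(2) d'_def using F(1) G(1) by (intro sum.mono_neutral_cong_left) auto
    ultimately show ?thesis
      by (simp only: distrib_right sum.distrib)
  qed
  then show ?thesis
    unfolding trig_poly_def using F(1) G(1)
    by (intro exI[of _ "F \<union> G"] exI[of _ "\<lambda>m. c' m + d' m"]) (simp add: fun_eq_iff)
qed

lemma trig_poly_sum: "(\<And>i. i \<in> A \<Longrightarrow> trig_poly b (f i)) \<Longrightarrow> trig_poly b (\<lambda>t. \<Sum>i\<in>A. f i t)"
  by (induction A rule: infinite_finite_induct) (auto intro: trig_poly_add trig_poly_const)

lemma trig_poly_mult:
  assumes "trig_poly b f" "trig_poly b g"
  shows "trig_poly b (\<lambda>t. f t * g t)"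
proof -
  obtain F c where F: "finite F" "f = (\<lambda>t. \<Sum>m\<in>F. c m * char_fun b m t)"
    using assms(1) unfolding trig_poly_def by blast
  obtain G d where G: "finite G" "g = (\<lambda>t. \<Sum>m\<in>G. d m * char_fun b m t)"
    using assms(2) unfolding trig_poly_def by blast
  have "(\<lambda>t. f t * g t) = (\<lambda>t. \<Sum>m\<in>F. \<Sum>n\<in>G. (c m * d n) * char_fun b (m + n) t)"
    unfolding F(2) G(2) sum_product by (simp add: char_fun_mult[symmetric] mult_ac)
  then show ?thesis
    by (simp add: trig_poly_sum trig_poly_single)
qed

text \<open>On the unit circle the conjugate of \<open>char_fun b 1 t\<close> is
  \<open>char_fun b (-1) t\<close>, so real and imaginary part are combinations of these two
  characters. Closure under sums and products then reaches every real polynomial in them.\<close>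

lemma trig_poly_polynomial:
  fixes p :: "complex \<Rightarrow> real"
  assumes "real_polynomial_function p"
  shows "trig_poly b (\<lambda>t. of_real (p (char_fun b 1 t)))"
  using assms
proof induction
  case (linear f)
  let ?z = "char_fun b 1"
  have "of_real (f (?z t)) = (of_real (f 1) / 2 + of_real (f \<i>) / (2 * \<i>)) * char_fun b 1 t
      + (of_real (f 1) / 2 - of_real (f \<i>) / (2 * \<i>)) * char_fun b (-1) t" for t
  proof -
    have "f (?z t) = f (Re (?z t) *\<^sub>R 1 + Im (?z t) *\<^sub>R \<i>)"
      by (intro arg_cong[where f=f]) (simp add: complex_eq_iff)
    also have "\<dots> = Re (?z t) * f 1 + Im (?z t) * f \<i>"
      by (simp only: bounded_linear.linear[OF linear, THEN linear_add] bounded_linear.linear[OF linear, THEN linear_scale] real_scaleR_def)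
    finally have f: "f (?z t) = Re (?z t) * f 1 + Im (?z t) * f \<i>" .
    show ?thesis
      unfolding f char_fun_cnj[symmetric] by (simp add: complex_eq_iff algebra_simps Re_divide Im_divide power2_eq_square)
  qed
  then show ?case
    by (simp only: trig_poly_add trig_poly_single)
next
  case (add f g)
  then show ?case by (simp add: trig_poly_add)
next
  case (mult f g)
  then show ?case by (simp add: trig_poly_mult)
qed (rule trig_poly_const)

text \<open>A continuous function on a period closes up to a function on the unit circle.\<close>

lemma trig_poly_uniform_approx:
  assumes "b > 0" and cont: "continuous_on {0..1/b} s" and per: "s 0 = s (1/b)" and "e > 0"
  shows "\<exists>p. trig_poly b p \<and> (\<forall>t\<in>{0..<1/b}. cmod (s t - p t) < e)"
proof -
  define k where "k u = s (u / b)" for u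
  have "path k"
    unfolding path_def k_def using assms
    by (intro continuous_on_compose2[OF cont]) (auto intro!: continuous_intros simp: field_simps)
  \<comment> \<open>\<open>Arg2pi\<close> jumps at 1, so continuity on the circle is not a matter of
    composing continuous maps. The circle map attached to a loop is continuous, and the loop
    \<open>k\<close> is homotopic to itself.\<close>
  then have "homotopic_loops UNIV k k"
    using per by (simp add: homotopic_loops_refl pathfinish_def pathstart_def k_def)
  from homotopic_with_imp_continuous[OF homotopic_loops_imp_homotopic_circlemaps[OF this]]
  have "continuous_on (sphere 0 1) (k \<circ> (\<lambda>z. Arg2pi z / (2 * pi)))"
    by simp
  from Stone_Weierstrass_polynomial_function[OF compact_sphere this \<open>e > 0\<close>]
  obtain G where G: "polynomial_function G"
    "\<And>z. z \<in> sphere 0 1 \<Longrightarrow> cmod ((k \<circ> (\<lambda>z. Arg2pi z / (2 * pi))) z - G z) < e"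
    by blast
  \<comment> \<open>Real and imaginary part are treated separately because
    \<open>trig_poly_polynomial\<close> takes real-valued polynomials.\<close>
  define p where "p t = of_real (Re (G (char_fun b 1 t))) + \<i> * of_real (Im (G (char_fun b 1 t)))" for t
  have "real_polynomial_function (Re \<circ> G)" "real_polynomial_function (Im \<circ> G)"
    using G(1) bounded_linear_Re bounded_linear_Im unfolding polynomial_function_def by blast+
  from this[THEN trig_poly_polynomial[of _ b]]
  have "trig_poly b p"
    unfolding p_def o_def by (intro trig_poly_add trig_poly_mult trig_poly_const)
  moreover have "cmod (s t - p t) < e" if t: "t \<in> {0..<1/b}" for t
  proof -
    have "Arg2pi (char_fun b 1 t) = Im (2 * of_real pi * \<i> * of_real (b * t))"
    proof -
      have "char_fun b 1 t = exp (2 * of_real pi * \<i> * of_real (b * t))"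
        by (simp add: char_fun_def mult_ac)
      moreover have "b * t < 1"
        using t \<open>b > 0\<close> by (simp add: field_simps)
      ultimately show ?thesis
        using t \<open>b > 0\<close> by (simp add: Arg2pi_exp del: of_real_mult)
    qed
    then have "s t = (k \<circ> (\<lambda>z. Arg2pi z / (2 * pi))) (char_fun b 1 t)"
      using \<open>b > 0\<close> by (simp add: k_def)
    moreover have "p t = G (char_fun b 1 t)"
      by (simp add: p_def complex_eq_iff)
    ultimately show ?thesis
      using G(2)[of "char_fun b 1 t"] by simp
  qed
  ultimately show ?thesis by blast
qed

section \<open>Density of trigonometric polynomials in L^2 of a period\<close>

lemma l2_norm_dominated_convergence:
  assumes "\<And>n. d n \<in> borel_measurable lborel" "integrable lborel w"
    and "AE x in lborel. (\<lambda>n. d n x) \<longlonglongrightarrow> 0" "\<And>n. AE x in lborel. (cmod (d n x))\<^sup>2 \<le> w x"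
  shows "(\<lambda>n. l2_norm (d n)) \<longlonglongrightarrow> 0"
proof -
  note [measurable] = assms(1)
  have "(\<lambda>n. LINT x|lborel. (cmod (d n x))\<^sup>2) \<longlonglongrightarrow> (LINT x|(lborel :: real measure). 0 :: real)"
  proof (rule integral_dominated_convergence[where w=w])
    show "AE x in lborel. (\<lambda>n. (cmod (d n x))\<^sup>2) \<longlonglongrightarrow> 0"
      using assms(3)
    proof eventually_elim
      case (elim x)
      from tendsto_power[OF tendsto_norm[OF elim], of 2] show ?case by simp
    qed
  qed (use assms in auto)
  from tendsto_real_sqrt[OF this] show ?thesis
    by (simp add: l2_norm_def)
qed

lemma trig_poly_measurable: "trig_poly b p \<Longrightarrow> p \<in> borel_measurable borel"
  unfolding trig_poly_def by auto

lemma trig_poly_bounded: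
  assumes "trig_poly b p"
  obtains K where "0 \<le> K" "\<And>t. cmod (p t) \<le> K"
proof -
  obtain F c where F: "p = (\<lambda>t. \<Sum>m\<in>F. c m * char_fun b m t)"
    using assms unfolding trig_poly_def by blast
  have "cmod (p t) \<le> (\<Sum>m\<in>F. cmod (c m))" for t
    unfolding F by (rule sum_norm_le) (simp add: norm_mult)
  then show ?thesis
    using that[of "\<Sum>m\<in>F. cmod (c m)"] by (simp add: sum_nonneg)
qed

lemma L2_indicator_bounded:
  assumes "\<phi> \<in> borel_measurable lborel" "\<And>t. cmod (\<phi> t) \<le> K"
  shows "(\<lambda>t. indicator {0..<a} t * \<phi> t) \<in> L2"
proof -
  have "(\<lambda>t. \<phi> t * indicator {0..<a} t) \<in> L2"
  proof (rule L2_mult_bounded(1)[where K=K])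
    have "integrable lborel (\<lambda>t. (cmod (indicator {0..<a} t))\<^sup>2)"
    proof (rule Bochner_Integration.integrable_cong[THEN iffD1, OF refl])
      show "integrable lborel (indicator {0..<a} :: real \<Rightarrow> real)"
        by (cases "0 \<le> a") auto
    qed (auto split: split_indicator)
    then show "(indicator {0..<a} :: real \<Rightarrow> complex) \<in> L2"
      by (simp add: L2_def)
    show "0 \<le> K"
      using assms(2)[of 0] norm_ge_zero order_trans by blast
  qed (use assms in auto)
  then show ?thesis by (simp add: mult.commute)
qed

text \<open>A measurable function is almost everywhere a limit of continuous ones. These are made
  uniformly bounded, for dominated convergence, and forced to 0 at both ends of the period, so that
  the uniform approximation on the circle applies to them.\<close>

lemma trig_poly_dense_bounded:
  fixes \<phi> :: "real \<Rightarrow> complex"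
  assumes "b > 0" and [measurable]: "\<phi> \<in> borel_measurable borel"
    and K: "K > 0" "\<And>t. cmod (\<phi> t) \<le> K" and "e > 0"
  shows "\<exists>p. trig_poly b p \<and> l2_norm (\<lambda>t. indicator {0..<1/b} t * (\<phi> t - p t)) < e"
proof -
  define a where "a = 1 / b"
  have a: "a > 0" using \<open>b > 0\<close> by (simp add: a_def)
  have "\<phi> measurable_on UNIV"
    by (rule lebesgue_measurable_imp_measurable_on) (auto intro: measurable_completion)
  then obtain N g where N: "negligible N" and g: "\<And>n. continuous_on UNIV (g n)"
    and lim: "\<And>t. t \<notin> N \<Longrightarrow> (\<lambda>n. g n t) \<longlonglongrightarrow> \<phi> t"
    unfolding measurable_on_def by auto
  have N: "AE t in lborel. t \<notin> N"
    using N AE_not_in[of N lebesgue] by (simp add: negligible_iff_null_sets AE_completion_iff)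
  \<comment> \<open>The radial retraction onto the disc of radius \<open>K\<close>: continuous, and
    the identity on the values of \<open>\<phi>\<close>.\<close>
  define cl where "cl z = z * of_real (K / max K (cmod z))" for z :: complex
  have cl_cont: "continuous_on UNIV cl"
    unfolding cl_def using K(1) by (intro continuous_intros) auto
  have cl_bound: "cmod (cl z) \<le> K" for z
    using K(1) by (auto simp: cl_def norm_mult norm_divide field_simps max_def)
  have cl_id: "cl z = z" if "cmod z \<le> K" for z
    using that K(1) by (simp add: cl_def)
  \<comment> \<open>A trapezoid that vanishes at 0 and \<open>a\<close> and equals 1 at each
    interior point for all large \<open>n\<close>. It is negative outside the period, hence
    \<open>s_bound\<close> is confined to the period.\<close>
  define \<eta> where "\<eta> n t = min 1 (real n * min t (a - t))" for n and t :: real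
  define s where "s n t = of_real (\<eta> n t) * cl (g n t)" for n t
  have s_cont: "continuous_on S (s n)" for n S
    unfolding s_def[abs_def] \<eta>_def
    by (intro continuous_intros continuous_on_compose2[OF cl_cont] continuous_on_subset[OF g]) auto
  have [measurable]: "s n \<in> borel_measurable borel" for n
    by (intro borel_measurable_continuous_onI s_cont)
  have s_bound: "cmod (s n t) \<le> K" if "t \<in> {0..<a}" for n t
  proof -
    have "0 \<le> \<eta> n t" "\<eta> n t \<le> 1"
      using that by (auto simp: \<eta>_def)
    then have "\<bar>\<eta> n t\<bar> * cmod (cl (g n t)) \<le> 1 * K"
      using cl_bound K(1) by (intro mult_mono) auto
    then show ?thesis by (simp add: s_def norm_mult)
  qed
  have "(\<lambda>n. l2_norm (\<lambda>t. indicator {0..<a} t * (\<phi> t - s n t))) \<longlonglongrightarrow> 0"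
  proof (rule l2_norm_dominated_convergence)
    show "integrable lborel (\<lambda>t. (2 * K)\<^sup>2 * indicator {0..<a} t)"
      using a by (intro integrable_mult_right) simp
    show "AE t in lborel. (cmod (indicator {0..<a} t * (\<phi> t - s n t)))\<^sup>2 \<le> (2 * K)\<^sup>2 * indicator {0..<a} t" for n
    proof (rule AE_I2)
      fix t
      have "(cmod (\<phi> t - s n t))\<^sup>2 \<le> (2 * K)\<^sup>2" if "t \<in> {0..<a}"
        using norm_triangle_ineq4[of "\<phi> t" "s n t"] s_bound[OF that, of n] K(2)[of t] by (intro power_mono) auto
      then show "(cmod (indicator {0..<a} t * (\<phi> t - s n t)))\<^sup>2 \<le> (2 * K)\<^sup>2 * indicator {0..<a} t"
        by (auto split: split_indicator)
    qed
    show "AE t in lborel. (\<lambda>n. indicator {0..<a} t * (\<phi> t - s n t)) \<longlonglongrightarrow> 0"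
      using N AE_lborel_singleton[of 0]
    proof eventually_elim
      case (elim t)
      have "(\<lambda>n. s n t) \<longlonglongrightarrow> \<phi> t" if t: "t \<in> {0..<a}"
      proof -
        have pos: "min t (a - t) > 0"
          using t elim by auto
        obtain n0 :: nat where n0: "1 / min t (a - t) \<le> real n0"
          using real_arch_simple by blast
        have "\<eta> n t = 1" if "n \<ge> n0" for n
        proof -
          have "1 / min t (a - t) \<le> real n"
            using n0 that by (simp add: order_trans)
          then have "1 \<le> real n * min t (a - t)"
            using pos by (simp only: pos_divide_le_eq)
          then show ?thesis unfolding \<eta>_def by (rule min_absorb1)
        qed
        then have "\<forall>\<^sub>F n in sequentially. of_real (\<eta> n t) = (1 :: complex)"
          unfolding eventually_sequentially by (intro exI[of _ n0]) auto
        then have 1: "(\<lambda>n. of_real (\<eta> n t) :: complex) \<longlonglongrightarrow> 1"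
          by (rule tendsto_eventually)
        have "(\<lambda>n. cl (g n t)) \<longlonglongrightarrow> cl (\<phi> t)"
          using elim by (intro continuous_on_tendsto_compose[OF cl_cont] lim) auto
        from tendsto_mult[OF 1 this] show ?thesis
          by (simp add: s_def cl_id K(2))
      qed
      then have "(\<lambda>n. \<phi> t - s n t) \<longlonglongrightarrow> \<phi> t - \<phi> t" if "t \<in> {0..<a}"
        using that by (intro tendsto_diff tendsto_const)
      then show ?case
        by (cases "t \<in> {0..<a}") simp_all
    qed
  qed measurable
  then have "\<forall>\<^sub>F n in sequentially. l2_norm (\<lambda>t. indicator {0..<a} t * (\<phi> t - s n t)) < e / 2"
    using \<open>e > 0\<close> by (intro order_tendstoD(2)) auto
  then obtain n where n: "l2_norm (\<lambda>t. indicator {0..<a} t * (\<phi> t - s n t)) < e / 2"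
    using eventually_happens'[OF sequentially_bot] by blast
  \<comment> \<open>A uniform error \<open>d\<close> on an interval of length \<open>a\<close> has
    norm at most \<open>d * sqrt a\<close>, which is \<open>e/2\<close>.\<close>
  define d where "d = e / (2 * sqrt a)"
  have d: "d > 0" using \<open>e > 0\<close> a by (simp add: d_def)
  have "s n 0 = s n a"
    using a by (simp add: s_def \<eta>_def)
  then obtain p where p: "trig_poly b p" "\<And>t. t \<in> {0..<a} \<Longrightarrow> cmod (s n t - p t) < d"
    using trig_poly_uniform_approx[OF \<open>b > 0\<close> s_cont _ d] unfolding a_def by blast
  have [measurable]: "p \<in> borel_measurable borel"
    by (rule trig_poly_measurable[OF p(1)])
  have bd: "(\<integral>\<^sup>+t. ennreal ((cmod (indicator {0..<a} t * (s n t - p t)))\<^sup>2) \<partial>lborel) \<le> ennreal ((e/2)\<^sup>2)"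
  proof -
    have "(\<integral>\<^sup>+t. ennreal ((cmod (indicator {0..<a} t * (s n t - p t)))\<^sup>2) \<partial>lborel)
        \<le> (\<integral>\<^sup>+t. ennreal (d\<^sup>2) * indicator {0..<a} t \<partial>lborel)"
      using power_mono[OF less_imp_le[OF p(2)], of _ 2] by (intro nn_integral_mono) (auto split: split_indicator)
    also have "\<dots> = ennreal (d\<^sup>2) * ennreal a"
      using a by (simp add: nn_integral_cmult_indicator)
    also have "\<dots> = ennreal (d\<^sup>2 * a)"
      using a by (simp add: ennreal_mult)
    also have "d\<^sup>2 * a = (e/2)\<^sup>2"
      using a by (simp add: d_def power_divide power_mult_distrib)
    finally show ?thesis .
  qed
  note sp = L2_and_l2_norm_leI[OF _ _ bd]
  have sp: "(\<lambda>t. indicator {0..<a} t * (s n t - p t)) \<in> L2" "l2_norm (\<lambda>t. indicator {0..<a} t * (s n t - p t)) \<le> e/2"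
    using sp \<open>e > 0\<close> by auto
  have \<phi>s: "(\<lambda>t. indicator {0..<a} t * (\<phi> t - s n t)) \<in> L2"
  proof -
    \<comment> \<open>\<open>L2_indicator_bounded\<close> asks for a bound on the whole line, which
      holds only after cutting off; the doubled indicator is then absorbed.\<close>
    have "(\<lambda>t. indicator {0..<a} t * (indicator {0..<a} t * (\<phi> t - s n t))) \<in> L2"
    proof (rule L2_indicator_bounded[where K="2 * K"])
      fix t
      show "cmod (indicator {0..<a} t * (\<phi> t - s n t)) \<le> 2 * K"
        using norm_triangle_ineq4[of "\<phi> t" "s n t"] s_bound[of t n] K(1) K(2)[of t] by (auto split: split_indicator)
    qed measurable
    moreover have "(\<lambda>t. indicator {0..<a} t * (indicator {0..<a} t * (\<phi> t - s n t))) = (\<lambda>t. indicator {0..<a} t * (\<phi> t - s n t))"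
      by (auto split: split_indicator)
    ultimately show ?thesis by simp
  qed
  have "l2_norm (\<lambda>t. indicator {0..<a} t * (\<phi> t - p t)) < e"
    using l2_norm_triangle[OF \<phi>s sp(1)] n sp(2) by (simp flip: distrib_left)
  then show ?thesis
    using p(1) unfolding a_def by blast
qed

text \<open>Setting \<open>\<phi>\<close> to 0 where it exceeds height \<open>n\<close> reduces to
  the bounded case; the error is dominated by \<open>\<phi>\<close> itself.\<close>

lemma trig_poly_dense:
  assumes "b > 0" "\<phi> \<in> L2" "e > 0"
  shows "\<exists>p. trig_poly b p \<and> l2_norm (\<lambda>t. indicator {0..<1/b} t * (\<phi> t - p t)) < e"
proof -
  have [measurable]: "\<phi> \<in> borel_measurable borel"
    using L2_measurable[OF assms(2)] by simp
  define T where "T n t = (if cmod (\<phi> t) \<le> real n then \<phi> t else 0)" for n t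
  have [measurable]: "T n \<in> borel_measurable borel" for n
    unfolding T_def[abs_def] by measurable
  have "(\<lambda>n. l2_norm (\<lambda>t. \<phi> t - T n t)) \<longlonglongrightarrow> 0"
  proof (rule l2_norm_dominated_convergence)
    show "integrable lborel (\<lambda>t. (cmod (\<phi> t))\<^sup>2)"
      by (rule L2_integrable) fact
    show "AE t in lborel. (\<lambda>n. \<phi> t - T n t) \<longlonglongrightarrow> 0"
    proof (rule AE_I2)
      fix t
      obtain n0 :: nat where "cmod (\<phi> t) \<le> real n0"
        using real_arch_simple by blast
      then have "\<forall>n\<ge>n0. \<phi> t - T n t = 0"
        by (auto simp: T_def)
      then show "(\<lambda>n. \<phi> t - T n t) \<longlonglongrightarrow> 0"
        by (intro tendsto_eventually) (auto simp: eventually_sequentially)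
    qed
  qed (auto simp: T_def)
  then have "\<forall>\<^sub>F n in sequentially. l2_norm (\<lambda>t. \<phi> t - T n t) < e / 2"
    using \<open>e > 0\<close> by (intro order_tendstoD(2)) auto
  then obtain n where n: "l2_norm (\<lambda>t. \<phi> t - T n t) < e / 2"
    using eventually_happens'[OF sequentially_bot] by blast
  have "\<exists>p. trig_poly b p \<and> l2_norm (\<lambda>t. indicator {0..<1/b} t * (T n t - p t)) < e / 2"
    \<comment> \<open>The bounded case wants \<open>K > 0\<close>, and \<open>n\<close> may be
      0.\<close>
    by (rule trig_poly_dense_bounded[where K="real n + 1"]) (use assms in \<open>auto simp: T_def\<close>)
  then obtain p where p: "trig_poly b p" "l2_norm (\<lambda>t. indicator {0..<1/b} t * (T n t - p t)) < e / 2"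
    by blast
  obtain K where K: "\<And>t. cmod (p t) \<le> K"
    using trig_poly_bounded[OF p(1)] by metis
  have [measurable]: "p \<in> borel_measurable borel"
    by (rule trig_poly_measurable[OF p(1)])
  have 1: "(\<lambda>t. \<phi> t - T n t) \<in> L2"
  proof -
    have "(\<lambda>t. (if cmod (\<phi> t) \<le> real n then 0 else 1) * \<phi> t) \<in> L2"
      by (rule L2_mult_bounded(1)[where K=1]) (use assms(2) in auto)
    moreover have "(\<lambda>t. (if cmod (\<phi> t) \<le> real n then 0 else 1) * \<phi> t) = (\<lambda>t. \<phi> t - T n t)"
      by (auto simp: T_def)
    ultimately show ?thesis by simp
  qed
  have 2: "(\<lambda>t. indicator {0..<1/b} t * (T n t - p t)) \<in> L2"
  proof (rule L2_indicator_bounded[where K="real n + K"])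
    fix t show "cmod (T n t - p t) \<le> real n + K"
      using norm_triangle_ineq4[of "T n t" "p t"] K[of t] by (auto simp: T_def split: if_splits)
  qed measurable
  have 3: "(\<lambda>t. indicator {0..<1/b} t * (\<phi> t - T n t)) \<in> L2"
    by (rule L2_indicator_mult[OF 1]) simp
  have "l2_norm (\<lambda>t. indicator {0..<1/b} t * (\<phi> t - T n t)) \<le> 1 * l2_norm (\<lambda>t. \<phi> t - T n t)"
    by (rule L2_mult_bounded(2)[OF 1]) (auto split: split_indicator)
  then have "l2_norm (\<lambda>t. indicator {0..<1/b} t * (\<phi> t - p t)) < e"
    using l2_norm_triangle[OF 3 2] n p(2) by (simp flip: distrib_left)
  then show ?thesis using p(1) by blast
qed

section \<open>Fourier series on a period\<close>

lemma orthogonal_norm_sq: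
  assumes "finite M" "\<And>i. i \<in> M \<Longrightarrow> e i \<in> L2"
    and orth: "\<And>i j. i \<in> M \<Longrightarrow> j \<in> M \<Longrightarrow> l2_inner (e i) (e j) = (if i = j then of_real \<kappa> else 0)"
  shows "(l2_norm (\<lambda>t. \<Sum>i\<in>M. d i * e i t))\<^sup>2 = \<kappa> * (\<Sum>i\<in>M. (cmod (d i))\<^sup>2)"
proof -
  let ?s = "\<lambda>t. \<Sum>i\<in>M. d i * e i t"
  have s: "?s \<in> L2" by (intro L2_sum L2_cmult assms)
  have "l2_inner (e i) ?s = cnj (d i) * of_real \<kappa>" if "i \<in> M" for i
  proof -
    have "l2_inner (e i) ?s = (\<Sum>j\<in>M. cnj (d j) * (if i = j then of_real \<kappa> else 0))"
      using that by (subst l2_inner_sum_right) (auto simp: l2_inner_cmult_right orth intro!: L2_cmult assms)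
    then show ?thesis
      using \<open>finite M\<close> that by (simp add: if_distrib cong: if_cong)
  qed
  then have "l2_inner ?s ?s = (\<Sum>i\<in>M. d i * (cnj (d i) * of_real \<kappa>))"
    by (subst l2_inner_sum_left) (auto simp: l2_inner_cmult_left intro!: L2_cmult assms s)
  also have "\<dots> = of_real (\<kappa> * (\<Sum>i\<in>M. (cmod (d i))\<^sup>2))"
    unfolding of_real_mult of_real_sum complex_norm_square sum_distrib_left by (simp add: mult_ac)
  finally show ?thesis
    unfolding l2_inner_self of_real_eq_iff .
qed

text \<open>The residual is orthogonal to every \<open>e i\<close>, so any other choice of
  coefficients adds the squared norm of the difference. The system is only orthogonal:
  \<open>\<kappa>\<close> is its common squared norm, \<open>1 / b\<close> for characters.\<close>

lemma orthogonal_best_approx: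
  assumes "finite M" "\<And>i. i \<in> M \<Longrightarrow> e i \<in> L2" "\<psi> \<in> L2" "\<kappa> > 0"
    and orth: "\<And>i j. i \<in> M \<Longrightarrow> j \<in> M \<Longrightarrow> l2_inner (e i) (e j) = (if i = j then of_real \<kappa> else 0)"
  shows "l2_norm (\<lambda>t. \<psi> t - (\<Sum>i\<in>M. l2_inner \<psi> (e i) / of_real \<kappa> * e i t))
    \<le> l2_norm (\<lambda>t. \<psi> t - (\<Sum>i\<in>M. d i * e i t))"
proof -
  define c where "c i = l2_inner \<psi> (e i) / of_real \<kappa>" for i
  define r where "r = (\<lambda>t. \<psi> t - (\<Sum>i\<in>M. c i * e i t))"
  let ?q = "\<lambda>t. \<Sum>i\<in>M. (c i - d i) * e i t"
  have r: "r \<in> L2" unfolding r_def by (intro L2_diff L2_sum L2_cmult assms)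
  have q: "?q \<in> L2" by (intro L2_sum L2_cmult assms)
  have "l2_inner r (e j) = 0" if "j \<in> M" for j
  proof -
    have "l2_inner r (e j) = l2_inner \<psi> (e j) - (\<Sum>i\<in>M. c i * (if i = j then of_real \<kappa> else 0))"
    proof -
      have "(\<lambda>t. \<Sum>i\<in>M. c i * e i t) \<in> L2"
        by (intro L2_sum L2_cmult assms)
      then have "l2_inner r (e j) = l2_inner \<psi> (e j) - l2_inner (\<lambda>t. \<Sum>i\<in>M. c i * e i t) (e j)"
        unfolding r_def by (intro l2_inner_diff_left assms that)
      also have "l2_inner (\<lambda>t. \<Sum>i\<in>M. c i * e i t) (e j) = (\<Sum>i\<in>M. l2_inner (\<lambda>t. c i * e i t) (e j))"
        by (intro l2_inner_sum_left L2_cmult assms that)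
      also have "\<dots> = (\<Sum>i\<in>M. c i * (if i = j then of_real \<kappa> else 0))"
        using that by (intro sum.cong refl) (simp add: l2_inner_cmult_left orth)
      finally show ?thesis .
    qed
    then show ?thesis
      using \<open>finite M\<close> that \<open>\<kappa> > 0\<close> by (simp add: c_def if_distrib cong: if_cong)
  qed
  then have "l2_inner r ?q = 0"
    by (subst l2_inner_sum_right) (auto simp: l2_inner_cmult_right intro!: L2_cmult assms r)
  moreover have "(\<lambda>t. \<psi> t - (\<Sum>i\<in>M. d i * e i t)) = (\<lambda>t. r t + ?q t)"
    by (simp add: r_def left_diff_distrib sum_subtractf)
  ultimately have "(l2_norm r)\<^sup>2 \<le> (l2_norm (\<lambda>t. \<psi> t - (\<Sum>i\<in>M. d i * e i t)))\<^sup>2"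
    using l2_norm_add_sq[OF r q] by simp
  then show ?thesis
    unfolding c_def[symmetric] r_def[symmetric] by (rule power2_le_imp_le) simp
qed

abbreviation char_on_period :: "real \<Rightarrow> int \<Rightarrow> real \<Rightarrow> complex" where
  "char_on_period b m \<equiv> (\<lambda>t. indicator {0..<1/b} t * char_fun b m t)"

lemma char_on_period_L2: "char_on_period b m \<in> L2"
  by (rule L2_indicator_bounded[where K=1]) auto

lemma char_on_period_orthogonal:
  assumes "b > 0"
  shows "l2_inner (char_on_period b m) (char_on_period b n) = (if m = n then of_real (1 / b) else 0)"
proof -
  have "l2_inner (char_on_period b m) (char_on_period b n)
      = (LINT t|lborel. indicator {0..<1/b} t * char_fun b (m + - n) t)"
    unfolding l2_inner_def char_fun_mult[symmetric] char_fun_cnj[symmetric]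
    by (intro Bochner_Integration.integral_cong) (auto split: split_indicator)
  then show ?thesis
    unfolding integral_char_fun[OF assms] by simp
qed

lemma indicator_trig_sum:
  "indicator A t * (\<Sum>m\<in>F. c m * char_fun b m t) = (\<Sum>m\<in>F. c m * (indicator A t * char_fun b m t))"
  by (simp add: sum_distrib_left mult_ac)

text \<open>Density yields a single polynomial with frequencies in \<open>F\<close>. Padded with
  zero coefficients it competes on every finite \<open>M\<close> containing \<open>F\<close>, and
  the Fourier sum over \<open>M\<close> is at least as good; hence convergence along all finite
  sets.\<close>

lemma Fourier_series_converges:
  assumes "b > 0" "\<psi> \<in> L2" "e > 0" and supp: "\<And>t. t \<notin> {0..<1/b} \<Longrightarrow> \<psi> t = 0"
  shows "\<exists>M0. finite M0 \<and> (\<forall>M. finite M \<and> M0 \<subseteq> M \<longrightarrow>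
    l2_norm (\<lambda>t. \<psi> t - (\<Sum>m\<in>M. of_real b * l2_inner \<psi> (char_on_period b m) * char_on_period b m t)) < e)"
proof -
  obtain p where p: "trig_poly b p" "l2_norm (\<lambda>t. indicator {0..<1/b} t * (\<psi> t - p t)) < e"
    using trig_poly_dense[OF assms(1-3)] by blast
  then obtain F c where F: "finite F" "p = (\<lambda>t. \<Sum>m\<in>F. c m * char_fun b m t)"
    unfolding trig_poly_def by blast
  show ?thesis
  proof (intro exI[of _ F] conjI allI impI F(1))
    fix M assume M: "finite M \<and> F \<subseteq> M"
    define d where "d m = (if m \<in> F then c m else 0)" for m
    have "l2_norm (\<lambda>t. \<psi> t - (\<Sum>m\<in>M. l2_inner \<psi> (char_on_period b m) / of_real (1 / b) * char_on_period b m t))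
        \<le> l2_norm (\<lambda>t. \<psi> t - (\<Sum>m\<in>M. d m * char_on_period b m t))"
      using M assms(1,2) by (intro orthogonal_best_approx char_on_period_L2 char_on_period_orthogonal) auto
    also have "(\<lambda>t. \<psi> t - (\<Sum>m\<in>M. d m * char_on_period b m t)) = (\<lambda>t. indicator {0..<1/b} t * (\<psi> t - p t))"
    proof
      fix t
      have "p t = (\<Sum>m\<in>M. d m * char_fun b m t)"
        unfolding F(2) d_def using M by (intro sum.mono_neutral_cong_left) auto
      then have "indicator {0..<1/b} t * p t = (\<Sum>m\<in>M. d m * char_on_period b m t)"
        by (simp only: indicator_trig_sum)
      then show "\<psi> t - (\<Sum>m\<in>M. d m * char_on_period b m t) = indicator {0..<1/b} t * (\<psi> t - p t)"
        using supp[of t] by (auto simp: right_diff_distrib indicator_def)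
    qed
    also note p(2)
    finally show "l2_norm (\<lambda>t. \<psi> t - (\<Sum>m\<in>M. of_real b * l2_inner \<psi> (char_on_period b m) * char_on_period b m t)) < e"
      by (simp add: mult.commute)
  qed
qed

section \<open>Modulates of a single function\<close>

lemma L2_char_fun_mult: "h \<in> L2 \<Longrightarrow> (\<lambda>t. char_fun b m t * h t) \<in> L2"
  by (rule L2_mult_bounded(1)[where K=1]) auto

lemma L2_trig_poly_mult:
  assumes "trig_poly b p" "h \<in> L2"
  shows "(\<lambda>t. p t * h t) \<in> L2"
proof -
  obtain K where "0 \<le> K" "\<And>t. cmod (p t) \<le> K"
    using trig_poly_bounded[OF assms(1)] by metis
  then show ?thesis
    using assms trig_poly_measurable by (intro L2_mult_bounded(1)[where K=K]) auto
qed

text \<open>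
  The synthesis bound reads \<open>\<integral>\<bar>p\<bar>\<^sup>2 w \<le> B b \<integral>\<bar>p\<bar>\<^sup>2\<close> over one period for trigonometric polynomials \<open>p\<close>,
  where \<open>w\<close> is the periodization of \<open>\<bar>h\<bar>\<^sup>2\<close>.  Truncating \<open>w\<close> lets this pass to the limit in \<open>p\<close>.
\<close>

lemma period_sq_bound:
  assumes "b > 0" "h \<in> L2" "0 \<le> B"
    and Bessel: "\<And>f F. f \<in> L2 \<Longrightarrow> finite F \<Longrightarrow>
      (\<Sum>m\<in>F. (cmod (l2_inner f (\<lambda>t. char_fun b m t * h t)))\<^sup>2) \<le> B * (l2_norm f)\<^sup>2"
  shows "AE t in lborel. period_sq (1 / b) h t \<le> B * b"
proof -
  define w where "w = period_sq (1 / b) h"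
  \<comment> \<open>Any level strictly above \<open>B * b\<close> would serve: truncating there
    leaves the set where \<open>w\<close> exceeds \<open>B * b\<close> visible.\<close>
  define K where "K = B * b + 1"
  have K: "K > 0" using assms by (simp add: K_def add_nonneg_pos)
  have [measurable]: "h \<in> borel_measurable borel"
    using L2_measurable[OF assms(2)] by simp
  have wm [measurable]: "w \<in> borel_measurable borel"
    unfolding w_def by (rule borel_measurable_period_sq) measurable
  have w_nonneg: "0 \<le> w t" for t by (simp add: w_def)
  let ?I = "{0..<1/b}"
  \<comment> \<open>The root of the truncated weight. Its product with a function has the truncated
    weighted norm, and being bounded it acts continuously on \<open>L2\<close>.\<close>
  let ?\<eta> = "\<lambda>t. complex_of_real (sqrt (min (w t) K))"
  have \<eta>_sq: "(cmod (?\<eta> t))\<^sup>2 = min (w t) K" for t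
    using w_nonneg[of t] K by simp
  have \<eta>_le: "cmod (?\<eta> t) \<le> sqrt K" for t
    using w_nonneg[of t] K by simp
  have poly: "l2_norm (\<lambda>t. ?\<eta> t * (indicator ?I t * p t)) \<le> sqrt (B * b) * l2_norm (\<lambda>t. indicator ?I t * p t)"
    if p: "trig_poly b p" for p
  proof -
    obtain F c where F: "finite F" "p = (\<lambda>t. \<Sum>m\<in>F. c m * char_fun b m t)"
      using p unfolding trig_poly_def by blast
    have [measurable]: "p \<in> borel_measurable borel"
      by (rule trig_poly_measurable[OF p])
    have per: "p (t - of_int k * (1/b)) = p t" for t k
      unfolding F(2) by (simp only: char_fun_periodic[OF \<open>b > 0\<close>])
    have ph: "(\<lambda>t. p t * h t) = (\<lambda>t. \<Sum>m\<in>F. c m * (char_fun b m t * h t))"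
      by (simp add: F(2) sum_distrib_right mult.assoc)
    have "(l2_norm (\<lambda>t. p t * h t))\<^sup>2 \<le> B * (\<Sum>m\<in>F. (cmod (c m))\<^sup>2)"
      unfolding ph using F(1) assms by (intro Bessel_synthesis_bound Bessel L2_char_fun_mult) auto
    also have "\<dots> = B * b * (1 / b * (\<Sum>m\<in>F. (cmod (c m))\<^sup>2))"
      using \<open>b > 0\<close> by simp
    \<comment> \<open>The characters are orthogonal with squared norm \<open>1 / b\<close> on the
      period; the factor \<open>b\<close> of the bound comes from here.\<close>
    also have "1 / b * (\<Sum>m\<in>F. (cmod (c m))\<^sup>2) = (l2_norm (\<lambda>t. \<Sum>m\<in>F. c m * char_on_period b m t))\<^sup>2"
      using F(1) by (intro orthogonal_norm_sq[symmetric] char_on_period_L2 char_on_period_orthogonal \<open>b > 0\<close>) auto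
    also have "(\<lambda>t. \<Sum>m\<in>F. c m * char_on_period b m t) = (\<lambda>t. indicator ?I t * p t)"
      unfolding F(2) indicator_trig_sum ..
    finally have 1: "(l2_norm (\<lambda>t. p t * h t))\<^sup>2 \<le> B * b * (l2_norm (\<lambda>t. indicator ?I t * p t))\<^sup>2" .
    have "(\<integral>\<^sup>+t. ennreal ((cmod (?\<eta> t * (indicator ?I t * p t)))\<^sup>2) \<partial>lborel)
        \<le> (\<integral>\<^sup>+t. ennreal (indicator ?I t * ((cmod (p t))\<^sup>2 * w t)) \<partial>lborel)"
    proof (intro nn_integral_mono ennreal_leI)
      fix t
      have "min (w t) K * (cmod (p t))\<^sup>2 \<le> w t * (cmod (p t))\<^sup>2"
        by (intro mult_right_mono) auto
      then show "(cmod (?\<eta> t * (indicator ?I t * p t)))\<^sup>2 \<le> indicator ?I t * ((cmod (p t))\<^sup>2 * w t)"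
        unfolding norm_mult power_mult_distrib \<eta>_sq by (simp add: mult_ac split: split_indicator)
    qed
    also have "\<dots> = ennreal ((l2_norm (\<lambda>t. p t * h t))\<^sup>2)"
      unfolding w_def using assms(1,2) per
      by (subst nn_integral_periodic_mult[symmetric]) (simp_all add: nn_integral_l2_norm[OF L2_trig_poly_mult[OF p assms(2)]])
    also have "\<dots> \<le> ennreal ((sqrt (B * b) * l2_norm (\<lambda>t. indicator ?I t * p t))\<^sup>2)"
      using 1 assms by (intro ennreal_leI) (simp add: power_mult_distrib)
    finally show ?thesis
      using assms by (intro L2_and_l2_norm_leI(2)) auto
  qed
  have gen: "l2_norm (\<lambda>t. ?\<eta> t * (indicator ?I t * \<phi> t)) \<le> sqrt (B * b) * l2_norm (\<lambda>t. indicator ?I t * \<phi> t)"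
    if \<phi>: "\<phi> \<in> L2" for \<phi>
  proof (rule field_le_epsilon)
    fix e :: real assume "e > 0"
    \<comment> \<open>The approximation error enters twice, once with factor \<open>sqrt K\<close>
      and once with \<open>sqrt (B * b)\<close>.\<close>
    define d where "d = e / (sqrt K + sqrt (B * b))"
    have sK: "sqrt K + sqrt (B * b) > 0"
      using K assms by (intro add_pos_nonneg) auto
    then have d: "d > 0" using \<open>e > 0\<close> by (simp add: d_def)
    obtain p where p: "trig_poly b p" "l2_norm (\<lambda>t. indicator ?I t * (\<phi> t - p t)) < d"
      using trig_poly_dense[OF \<open>b > 0\<close> \<phi> d] by blast
    have I\<phi>: "(\<lambda>t. indicator ?I t * \<phi> t) \<in> L2"
      by (rule L2_indicator_mult[OF \<phi>]) simp
    obtain Kp where "\<And>t. cmod (p t) \<le> Kp"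
      using trig_poly_bounded[OF p(1)] by metis
    then have Ip: "(\<lambda>t. indicator ?I t * p t) \<in> L2"
      using trig_poly_measurable[OF p(1)] by (intro L2_indicator_bounded) auto
    have diff: "(\<lambda>t. indicator ?I t * (\<phi> t - p t)) \<in> L2"
      using L2_diff[OF I\<phi> Ip] by (simp only: right_diff_distrib)
    have \<eta>L: "(\<lambda>t. ?\<eta> t * u t) \<in> L2" "l2_norm (\<lambda>t. ?\<eta> t * u t) \<le> sqrt K * l2_norm u" if "u \<in> L2" for u
      by (rule L2_mult_bounded[OF that, where K="sqrt K"]; use \<eta>_le K in auto)+
    have "l2_norm (\<lambda>t. ?\<eta> t * (indicator ?I t * \<phi> t))
        \<le> l2_norm (\<lambda>t. ?\<eta> t * (indicator ?I t * (\<phi> t - p t))) + l2_norm (\<lambda>t. ?\<eta> t * (indicator ?I t * p t))"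
      using l2_norm_triangle[OF \<eta>L(1)[OF diff] \<eta>L(1)[OF Ip]] by (simp add: algebra_simps)
    also have "\<dots> \<le> sqrt K * d + sqrt (B * b) * l2_norm (\<lambda>t. indicator ?I t * p t)"
      using \<eta>L(2)[OF diff] p(2) K by (intro add_mono poly[OF p(1)] order_trans[OF \<eta>L(2)[OF diff]] mult_left_mono) auto
    also have "l2_norm (\<lambda>t. indicator ?I t * p t)
        \<le> l2_norm (\<lambda>t. indicator ?I t * \<phi> t) + l2_norm (\<lambda>t. indicator ?I t * (\<phi> t - p t))"
      using l2_norm_triangle_mid[OF Ip I\<phi> L2_zero]
      unfolding right_diff_distrib
      by (simp add: l2_norm_minus_commute[of "\<lambda>t. indicator ?I t * p t" "\<lambda>t. indicator ?I t * \<phi> t"])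
    also have "\<dots> \<le> l2_norm (\<lambda>t. indicator ?I t * \<phi> t) + d"
      using p(2) by simp
    finally have "l2_norm (\<lambda>t. ?\<eta> t * (indicator ?I t * \<phi> t))
        \<le> sqrt K * d + sqrt (B * b) * (l2_norm (\<lambda>t. indicator ?I t * \<phi> t) + d)"
      using assms by (simp add: mult_left_mono)
    also have "\<dots> = sqrt (B * b) * l2_norm (\<lambda>t. indicator ?I t * \<phi> t) + (sqrt K + sqrt (B * b)) * d"
      by (simp add: algebra_simps)
    also have "(sqrt K + sqrt (B * b)) * d = e"
      using sK by (simp add: d_def)
    finally show "l2_norm (\<lambda>t. ?\<eta> t * (indicator ?I t * \<phi> t)) \<le> sqrt (B * b) * l2_norm (\<lambda>t. indicator ?I t * \<phi> t) + e" .
  qed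
  \<comment> \<open>Test on the indicator of the bad set: the truncated weight exceeds
    \<open>B * b\<close> on all of \<open>A\<close>, yet its integral over \<open>A\<close> is at
    most \<open>B * b\<close> times the measure of \<open>A\<close>. So \<open>A\<close> is
    null.\<close>
  define A where "A = {t \<in> ?I. w t > B * b}"
  have A [measurable]: "A \<in> sets borel"
    unfolding A_def by measurable
  have "emeasure lborel A \<le> emeasure lborel ?I"
    by (intro emeasure_mono) (auto simp: A_def)
  then have A_fin: "emeasure lborel A < \<infinity>"
    using \<open>b > 0\<close> by (auto intro: le_less_trans)
  then have intA: "integrable lborel (indicator A :: real \<Rightarrow> real)"
    by simp
  have ind_sq: "(\<lambda>t. (cmod (indicator A t))\<^sup>2) = (indicator A :: real \<Rightarrow> real)"
    by (auto split: split_indicator)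
  have A_L2: "(indicator A :: real \<Rightarrow> complex) \<in> L2"
    using intA by (simp add: L2_def ind_sq)
  have IA: "indicator ?I t * (indicator A t :: complex) = indicator A t" for t
    by (auto simp: A_def split: split_indicator)
  have "(l2_norm (\<lambda>t. ?\<eta> t * indicator A t))\<^sup>2 \<le> (sqrt (B * b) * l2_norm (indicator A))\<^sup>2"
    using gen[OF A_L2] by (intro power_mono) (simp_all add: IA)
  then have "(LINT t|lborel. min (w t) K * indicator A t) \<le> B * b * (LINT t|lborel. indicator A t)"
    using assms unfolding power_mult_distrib l2_norm_sq norm_mult ind_sq \<eta>_sq by (simp add: fun_cong[OF ind_sq])
  moreover have int: "integrable lborel (\<lambda>t. min (w t) K * indicator A t)"
  proof (rule Bochner_Integration.integrable_bound)
    show "integrable lborel (\<lambda>t. K * indicator A t)"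
      by (intro integrable_mult_right intA)
    show "AE t in lborel. norm (min (w t) K * indicator A t) \<le> norm (K * indicator A t)"
      using w_nonneg K by (auto simp: abs_mult split: split_indicator)
  qed measurable
  ultimately have "(LINT t|lborel. min (w t) K * indicator A t - B * b * indicator A t) \<le> 0"
    using intA by (subst Bochner_Integration.integral_diff) auto
  moreover have nonneg: "0 \<le> min (w t) K * indicator A t - B * b * indicator A t" for t
    by (auto simp: A_def K_def split: split_indicator)
  moreover have int2: "integrable lborel (\<lambda>t. min (w t) K * indicator A t - B * b * indicator A t)"
    using int intA by auto
  ultimately have "(LINT t|lborel. min (w t) K * indicator A t - B * b * indicator A t) = 0"
    by (intro order_antisym Bochner_Integration.integral_nonneg) auto
  then have "AE t in lborel. min (w t) K * indicator A t - B * b * indicator A t = 0"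
    using integral_nonneg_eq_0_iff_AE[OF int2] nonneg by simp
  then have "AE t in lborel. t \<in> ?I \<longrightarrow> w t \<le> B * b"
    by eventually_elim (auto simp: A_def K_def min_def split: split_indicator_asm if_splits)
  then show ?thesis
    unfolding w_def[symmetric]
  proof (rule AE_periodic[rotated 3])
    show "w (t - of_int k * (1/b)) \<le> B * b \<longleftrightarrow> w t \<le> B * b" for t k
      by (simp only: w_def period_sq_periodic)
  qed (use \<open>b > 0\<close> in simp_all)
qed

section \<open>Multiplication of a window by periodic functions\<close>

lemma nn_integral_period_sq:
  assumes "P > 0" "f \<in> L2"
  shows "(\<integral>\<^sup>+t. ennreal (indicator {0..<P} t * period_sq P f t) \<partial>lborel) = ennreal ((l2_norm f)\<^sup>2)"
  using nn_integral_periodic_mult[OF assms, of "\<lambda>_. 1"] nn_integral_l2_norm[OF assms(2)] by simp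

text \<open>With weight at most \<open>C\<close>, the weighted norm over a period is at most
  \<open>sqrt C\<close> times the plain one. This replaces estimates of infinitely many modulates by
  an estimate of one periodic function.\<close>

lemma periodic_mult_bounded:
  assumes "P > 0" "h \<in> L2" "0 \<le> C" and C: "AE t in lborel. period_sq P h t \<le> C"
    and \<phi>: "\<phi> \<in> borel_measurable borel" "\<And>t (k::int). \<phi> (t - of_int k * P) = \<phi> t"
    and L: "(\<lambda>t. indicator {0..<P} t * \<phi> t) \<in> L2"
  shows "(\<lambda>t. \<phi> t * h t) \<in> L2"
    and "l2_norm (\<lambda>t. \<phi> t * h t) \<le> sqrt C * l2_norm (\<lambda>t. indicator {0..<P} t * \<phi> t)"
proof -
  have [measurable]: "h \<in> borel_measurable borel" "\<phi> \<in> borel_measurable borel"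
    using L2_measurable[OF assms(2)] \<phi> by simp_all
  have "(\<integral>\<^sup>+t. ennreal ((cmod (\<phi> t * h t))\<^sup>2) \<partial>lborel)
    = (\<integral>\<^sup>+t. ennreal (indicator {0..<P} t * ((cmod (\<phi> t))\<^sup>2 * period_sq P h t)) \<partial>lborel)"
    by (rule nn_integral_periodic_mult[OF assms(1,2) \<phi>])
  also have "\<dots> \<le> (\<integral>\<^sup>+t. ennreal C * ennreal ((cmod (indicator {0..<P} t * \<phi> t))\<^sup>2) \<partial>lborel)"
    using C
  proof (intro nn_integral_mono_AE, eventually_elim)
    case (elim t)
    then have "(cmod (\<phi> t))\<^sup>2 * period_sq P h t \<le> C * (cmod (\<phi> t))\<^sup>2"
      by (subst mult.commute) (intro mult_right_mono, auto)
    then show ?case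
      using \<open>0 \<le> C\<close> by (auto simp: ennreal_mult'[symmetric] intro!: ennreal_leI split: split_indicator)
  qed
  also have "\<dots> = ennreal C * ennreal ((l2_norm (\<lambda>t. indicator {0..<P} t * \<phi> t))\<^sup>2)"
    using nn_integral_l2_norm[OF L] by (subst nn_integral_cmult) auto
  also have "\<dots> = ennreal ((sqrt C * l2_norm (\<lambda>t. indicator {0..<P} t * \<phi> t))\<^sup>2)"
    using \<open>0 \<le> C\<close> by (simp add: ennreal_mult power_mult_distrib)
  finally have *: "(\<integral>\<^sup>+t. ennreal ((cmod (\<phi> t * h t))\<^sup>2) \<partial>lborel) \<le> \<dots>" .
  show "(\<lambda>t. \<phi> t * h t) \<in> L2"
    "l2_norm (\<lambda>t. \<phi> t * h t) \<le> sqrt C * l2_norm (\<lambda>t. indicator {0..<P} t * \<phi> t)"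
    using L2_and_l2_norm_leI[OF _ _ *] \<open>0 \<le> C\<close> by auto
qed

text \<open>By Cauchy-Schwarz the squared bracket is at most \<open>C * period_sq P f\<close>, and
  the latter integrates over the period to \<open>C\<close> times the squared norm of
  \<open>f\<close>.\<close>

lemma bracket_L2_on_period:
  assumes "P > 0" "f \<in> L2" "h \<in> L2" "0 \<le> C" and C: "AE t in lborel. period_sq P h t \<le> C"
  shows "(\<lambda>t. indicator {0..<P} t * bracket P f h t) \<in> L2"
proof -
  have [measurable]: "h \<in> borel_measurable borel" "f \<in> borel_measurable borel"
    using L2_measurable[OF assms(2)] L2_measurable[OF assms(3)] by simp_all
  note [measurable] = borel_measurable_bracket borel_measurable_period_sq
  have "(\<integral>\<^sup>+t. ennreal ((cmod (indicator {0..<P} t * bracket P f h t))\<^sup>2) \<partial>lborel)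
     \<le> (\<integral>\<^sup>+t. ennreal C * ennreal (indicator {0..<P} t * period_sq P f t) \<partial>lborel)"
    using C bracket_Cauchy_Schwarz[OF assms(1-3)]
  proof (intro nn_integral_mono_AE, eventually_elim)
    case (elim t)
    have "(cmod (bracket P f h t))\<^sup>2 \<le> period_sq P f t * C"
      using elim by (elim order_trans) (intro mult_left_mono, auto)
    then show ?case
      using \<open>0 \<le> C\<close> by (auto simp: ennreal_mult'[symmetric] mult.commute intro!: ennreal_leI split: split_indicator)
  qed
  also have "\<dots> = ennreal C * ennreal ((l2_norm f)\<^sup>2)"
    using nn_integral_period_sq[OF assms(1,2)] by (subst nn_integral_cmult) auto
  also have "\<dots> < \<infinity>"
    by (simp add: ennreal_mult_less_top)
  finally show ?thesis
    by (simp add: L2_iff_nn_integral)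
qed

lemma bracket_mult_L2:
  assumes "P > 0" "f \<in> L2" "h \<in> L2" "0 \<le> C" "AE t in lborel. period_sq P h t \<le> C"
  shows "(\<lambda>t. bracket P f h t * h t) \<in> L2"
proof (rule periodic_mult_bounded(1)[OF assms(1,3-5)])
  show "bracket P f h \<in> borel_measurable borel"
    using L2_measurable[OF assms(2)] L2_measurable[OF assms(3)] by (intro borel_measurable_bracket) simp_all
qed (rule bracket_periodic bracket_L2_on_period[OF assms])+

lemma l2_inner_modulate:
  assumes "b > 0" "f \<in> L2" "h \<in> L2"
  shows "l2_inner f (\<lambda>t. char_fun b m t * h t)
    = l2_inner (\<lambda>t. indicator {0..<1/b} t * bracket (1/b) f h t) (char_on_period b m)"
proof -
  have "l2_inner f (\<lambda>t. char_fun b m t * h t)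
      = (LINT t|lborel. indicator {0..<1/b} t * (bracket (1/b) f h t * cnj (char_fun b m t)))"
    using assms by (intro l2_inner_periodic_mult L2_char_fun_mult char_fun_periodic) auto
  also have "\<dots> = l2_inner (\<lambda>t. indicator {0..<1/b} t * bracket (1/b) f h t) (char_on_period b m)"
    unfolding l2_inner_def by (intro Bochner_Integration.integral_cong) (auto split: split_indicator)
  finally show ?thesis .
qed

text \<open>The inner products are Fourier coefficients of the bracket without the factor
  \<open>b\<close> that normalises the characters, so the series adds up to \<open>1/b\<close> times
  bracket times \<open>h\<close>.\<close>

lemma modulates_l2_has_sum:
  assumes "b > 0" "f \<in> L2" "h \<in> L2" "0 \<le> C" and C: "AE t in lborel. period_sq (1/b) h t \<le> C"
  shows "l2_has_sum (\<lambda>m t. l2_inner f (\<lambda>t. char_fun b m t * h t) * (char_fun b m t * h t))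
    (\<lambda>t. of_real (1/b) * (bracket (1/b) f h t * h t))"
  unfolding l2_has_sum_iff
proof (intro conjI allI impI)
  let ?P = "1 / b"
  have P: "?P > 0" using \<open>b > 0\<close> by simp
  define c where "c m = l2_inner f (\<lambda>t. char_fun b m t * h t)" for m
  define \<psi> where "\<psi> = (\<lambda>t. indicator {0..<?P} t * bracket ?P f h t)"
  have c: "c m = l2_inner \<psi> (char_on_period b m)" for m
    unfolding c_def \<psi>_def by (rule l2_inner_modulate[OF assms(1-3)])
  have \<psi>: "\<psi> \<in> L2"
    unfolding \<psi>_def by (rule bracket_L2_on_period[OF P assms(2-5)])
  note [measurable] = borel_measurable_bracket
  have [measurable]: "h \<in> borel_measurable borel" "f \<in> borel_measurable borel"
    using L2_measurable[OF assms(2)] L2_measurable[OF assms(3)] by simp_all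
  show "(\<lambda>t. c m * (char_fun b m t * h t)) \<in> L2" for m
    by (intro L2_cmult L2_char_fun_mult assms)
  show "(\<lambda>t. of_real ?P * (bracket ?P f h t * h t)) \<in> L2"
    by (intro L2_cmult bracket_mult_L2[OF P assms(2-5)])
  fix e :: real assume "e > 0"
  \<comment> \<open>The Fourier error passes through the factor \<open>1/b\<close> and through
    multiplication by \<open>h\<close>, of norm at most \<open>sqrt C\<close>; the added 1 allows
    \<open>C = 0\<close>.\<close>
  define d where "d = e * b / (sqrt C + 1)"
  have sC: "sqrt C + 1 > 0" using \<open>0 \<le> C\<close> by (simp add: add_nonneg_pos)
  have d: "d > 0" using \<open>e > 0\<close> \<open>b > 0\<close> sC by (simp add: d_def)
  obtain M0 where M0: "finite M0" "\<And>M. finite M \<Longrightarrow> M0 \<subseteq> M \<Longrightarrow>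
      l2_norm (\<lambda>t. \<psi> t - (\<Sum>m\<in>M. of_real b * c m * char_on_period b m t)) < d"
    using Fourier_series_converges[OF \<open>b > 0\<close> \<psi> d] unfolding c[symmetric] by (auto simp: \<psi>_def)
  have "l2_norm (\<lambda>t. (\<Sum>m\<in>M. c m * (char_fun b m t * h t)) - of_real ?P * (bracket ?P f h t * h t)) < e"
    if M: "finite M" "M0 \<subseteq> M" for M
  proof -
    define \<phi> where "\<phi> t = (\<Sum>m\<in>M. c m * char_fun b m t) - of_real ?P * bracket ?P f h t" for t
    have [measurable]: "\<phi> \<in> borel_measurable borel"
      unfolding \<phi>_def[abs_def] by measurable
    have per: "\<phi> (t - of_int k * ?P) = \<phi> t" for t k
      unfolding \<phi>_def by (simp only: char_fun_periodic[OF \<open>b > 0\<close>] bracket_periodic)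
    have eq: "(\<lambda>t. indicator {0..<?P} t * \<phi> t)
        = (\<lambda>t. of_real (-?P) * (\<psi> t - (\<Sum>m\<in>M. of_real b * c m * char_on_period b m t)))"
    proof
      fix t
      have "(\<Sum>m\<in>M. of_real b * c m * char_on_period b m t) = of_real b * (indicator {0..<?P} t * (\<Sum>m\<in>M. c m * char_fun b m t))"
        by (simp add: sum_distrib_left mult_ac)
      then show "indicator {0..<?P} t * \<phi> t = of_real (-?P) * (\<psi> t - (\<Sum>m\<in>M. of_real b * c m * char_on_period b m t))"
        using \<open>b > 0\<close> by (simp add: \<phi>_def \<psi>_def field_simps)
    qed
    have L: "(\<lambda>t. indicator {0..<?P} t * \<phi> t) \<in> L2"
      unfolding eq by (intro L2_cmult L2_diff \<psi> L2_sum char_on_period_L2)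
    have "l2_norm (\<lambda>t. \<phi> t * h t) \<le> sqrt C * l2_norm (\<lambda>t. indicator {0..<?P} t * \<phi> t)"
      by (rule periodic_mult_bounded(2)[OF P assms(3-5) _ per L]) measurable
    also have "\<dots> \<le> (sqrt C + 1) * l2_norm (\<lambda>t. indicator {0..<?P} t * \<phi> t)"
      by (intro mult_right_mono) auto
    also have "\<dots> = (sqrt C + 1) * (?P * l2_norm (\<lambda>t. \<psi> t - (\<Sum>m\<in>M. of_real b * c m * char_on_period b m t)))"
      unfolding eq l2_norm_cmult using \<open>b > 0\<close> by (simp del: of_real_divide)
    also have "\<dots> < (sqrt C + 1) * (?P * d)"
      using M0(2)[OF M] P sC by (intro mult_strict_left_mono) auto
    also have "\<dots> = e"
      using sC \<open>b > 0\<close> by (simp add: d_def)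
    also have "(\<lambda>t. \<phi> t * h t) = (\<lambda>t. (\<Sum>m\<in>M. c m * (char_fun b m t * h t)) - of_real ?P * (bracket ?P f h t * h t))"
      by (simp add: \<phi>_def left_diff_distrib sum_distrib_right mult.assoc)
    finally show ?thesis .
  qed
  then show "\<exists>A. finite A \<and> (\<forall>F. finite F \<and> A \<subseteq> F \<longrightarrow>
      l2_norm (\<lambda>t. (\<Sum>m\<in>F. c m * (char_fun b m t * h t)) - of_real ?P * (bracket ?P f h t * h t)) < e)"
    using M0(1) by blast
qed

section \<open>Orthogonal projections\<close>

text \<open>Identifies the representative chosen by \<open>SOME\<close> from any one candidate: the
  difference of the two is orthogonal to both of them, as both lie in \<open>V\<close>, hence to
  itself.\<close>

lemma orth_proj_unique:
  assumes V: "V \<subseteq> L2" and f: "f \<in> L2" and h: "h \<in> V" "\<And>v. v \<in> V \<Longrightarrow> l2_inner (\<lambda>t. f t - h t) v = 0"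
  shows "orth_proj V f \<in> V" and "AE t in lborel. orth_proj V f t = h t"
proof -
  let ?q = "orth_proj V f"
  have q: "?q \<in> V \<and> (\<forall>v\<in>V. l2_inner (\<lambda>t. f t - ?q t) v = 0)"
    unfolding orth_proj_def by (rule someI[of _ h]) (use h in blast)
  then show "?q \<in> V" by blast
  have L: "h \<in> L2" "?q \<in> L2" using V h(1) q by auto
  have "l2_inner (\<lambda>t. ?q t - h t) v = 0" if "v \<in> V" for v
  proof -
    have v: "v \<in> L2" using that V by blast
    have "l2_inner (\<lambda>t. ?q t - h t) v = l2_inner (\<lambda>t. f t - h t) v - l2_inner (\<lambda>t. f t - ?q t) v"
      by (simp add: l2_inner_diff_left f L v)
    then show ?thesis using h(2) q that by simp
  qed
  then have "l2_inner (\<lambda>t. ?q t - h t) (\<lambda>t. ?q t - h t) = 0"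
    using q h(1) L by (subst l2_inner_diff_right) (auto intro: L2_diff)
  then have "l2_norm (\<lambda>t. ?q t - h t) = 0"
    by (simp add: l2_inner_self)
  from l2_norm_eq_0_imp_AE[OF L2_diff[OF L(2,1)] this]
  show "AE t in lborel. ?q t = h t" by simp
qed

lemma orthogonal_closed_span:
  assumes e: "\<And>i. e i \<in> L2" and r: "r \<in> L2" "\<And>i. l2_inner r (e i) = 0" and v: "v \<in> l2_closed_span e"
  shows "l2_inner r v = 0"
proof -
  have vL: "v \<in> L2" using v by (simp add: l2_closed_span_def)
  have "cmod (l2_inner r v) \<le> 0 + \<epsilon>" if "\<epsilon> > 0" for \<epsilon>
  proof -
    define d where "d = \<epsilon> / (l2_norm r + 1)"
    have pos: "l2_norm r + 1 > 0" by (simp add: add_nonneg_pos)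
    then have d: "d > 0" using that by (simp add: d_def)
    then obtain F c where F: "finite F" "l2_norm (\<lambda>t. v t - (\<Sum>i\<in>F. c i * e i t)) < d"
      using v unfolding l2_closed_span_def by blast
    let ?s = "\<lambda>t. \<Sum>i\<in>F. c i * e i t"
    have s: "?s \<in> L2" by (intro L2_sum L2_cmult e)
    have "l2_inner r ?s = 0"
      by (subst l2_inner_sum_right) (auto simp: l2_inner_cmult_right r intro: L2_cmult e)
    then have "l2_inner r v = l2_inner r (\<lambda>t. v t - ?s t)"
      by (simp add: l2_inner_diff_right vL s r)
    then have "cmod (l2_inner r v) \<le> l2_norm r * l2_norm (\<lambda>t. v t - ?s t)"
      using l2_Cauchy_Schwarz[OF r(1) L2_diff[OF vL s]] by simp
    also have "\<dots> \<le> (l2_norm r + 1) * d"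
      using F(2) by (intro mult_mono) auto
    also have "\<dots> = \<epsilon>" using pos by (simp add: d_def)
    finally show ?thesis by simp
  qed
  then have "cmod (l2_inner r v) \<le> 0"
    by (rule field_le_epsilon)
  then show ?thesis by simp
qed

text \<open>
  The projection onto the span of the modulates of \<open>h\<close> multiplies \<open>h\<close> by the periodic function
  \<open>\<langle>f, h\<rangle> / \<parallel>h\<parallel>\<^sup>2\<close>, with value \<open>0\<close> where the denominator vanishes.
\<close>

definition bracket_quot :: "real \<Rightarrow> (real \<Rightarrow> complex) \<Rightarrow> (real \<Rightarrow> complex) \<Rightarrow> real \<Rightarrow> complex" where
  "bracket_quot P f h t = bracket P f h t / of_real (period_sq P h t)"

lemma bracket_quot_periodic: "bracket_quot P f h (t - of_int k * P) = bracket_quot P f h t"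
  unfolding bracket_quot_def bracket_periodic period_sq_periodic ..

lemma borel_measurable_bracket_quot:
  assumes "f \<in> L2" "h \<in> L2"
  shows "bracket_quot P f h \<in> borel_measurable borel"
proof -
  have [measurable]: "f \<in> borel_measurable borel" "h \<in> borel_measurable borel"
    using L2_measurable[OF assms(1)] L2_measurable[OF assms(2)] by simp_all
  note [measurable] = borel_measurable_bracket borel_measurable_period_sq
  show ?thesis unfolding bracket_quot_def[abs_def] by measurable
qed

text \<open>Where the denominator vanishes, Cauchy-Schwarz makes the bracket vanish too, so the
  value 0 of the quotient is the right one.\<close>

lemma bracket_quot_mult_period_sq:
  assumes "P > 0" "f \<in> L2" "h \<in> L2"
  shows "AE t in lborel. bracket_quot P f h t * of_real (period_sq P h t) = bracket P f h t"
  using bracket_Cauchy_Schwarz[OF assms]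
  by eventually_elim (auto simp: bracket_quot_def)

text \<open>The quotient alone may be unbounded, but its squared modulus times the weight is at most
  \<open>period_sq P f\<close>, again by Cauchy-Schwarz.\<close>

lemma bracket_quot_mult_L2:
  assumes "P > 0" "f \<in> L2" "h \<in> L2"
  shows "(\<lambda>t. bracket_quot P f h t * h t) \<in> L2"
proof -
  have [measurable]: "h \<in> borel_measurable borel"
    using L2_measurable[OF assms(3)] by simp
  note [measurable] = borel_measurable_bracket_quot[OF assms(2,3)]
  have "(\<integral>\<^sup>+t. ennreal ((cmod (bracket_quot P f h t * h t))\<^sup>2) \<partial>lborel)
      = (\<integral>\<^sup>+t. ennreal (indicator {0..<P} t * ((cmod (bracket_quot P f h t))\<^sup>2 * period_sq P h t)) \<partial>lborel)"
    by (rule nn_integral_periodic_mult[OF assms(1,3) _ bracket_quot_periodic]) measurable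
  also have "\<dots> \<le> (\<integral>\<^sup>+t. ennreal (indicator {0..<P} t * period_sq P f t) \<partial>lborel)"
    using bracket_Cauchy_Schwarz[OF assms]
  proof (intro nn_integral_mono_AE, eventually_elim)
    case (elim t)
    have "(cmod (bracket_quot P f h t))\<^sup>2 * period_sq P h t \<le> period_sq P f t"
    proof (cases "period_sq P h t = 0")
      case False
      then have pos: "period_sq P h t > 0" by (simp add: order_less_le)
      have "(cmod (bracket_quot P f h t))\<^sup>2 * period_sq P h t = (cmod (bracket P f h t))\<^sup>2 / period_sq P h t"
        using pos by (simp add: bracket_quot_def norm_divide power_divide power2_eq_square)
      also have "\<dots> \<le> period_sq P f t"
        using elim pos by (simp add: pos_divide_le_eq)
      finally show ?thesis .
    qed simp
    then show ?case
      by (intro ennreal_leI mult_left_mono) auto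
  qed
  also have "\<dots> < \<infinity>"
    by (simp add: nn_integral_period_sq assms)
  finally show ?thesis
    by (simp add: L2_iff_nn_integral)
qed

text \<open>Bracketing the candidate with \<open>h\<close> pulls out the periodic quotient and gives
  back the bracket of \<open>f\<close> with \<open>h\<close> almost everywhere; the candidate and
  \<open>f\<close> thus have the same coefficients against all modulates.\<close>

lemma bracket_quot_residual_orthogonal:
  assumes "b > 0" "f \<in> L2" "h \<in> L2"
  shows "l2_inner (\<lambda>t. f t - bracket_quot (1/b) f h t * h t) (\<lambda>t. char_fun b m t * h t) = 0"
proof -
  let ?P = "1 / b"
  have P: "?P > 0" using assms by simp
  let ?\<phi> = "bracket_quot ?P f h"
  note L = bracket_quot_mult_L2[OF P assms(2,3)]
  have [measurable]: "f \<in> borel_measurable borel" "h \<in> borel_measurable borel"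
    using L2_measurable[OF assms(2)] L2_measurable[OF assms(3)] by simp_all
  note [measurable] = borel_measurable_bracket_quot[OF assms(2,3)] borel_measurable_bracket
  have br: "bracket ?P (\<lambda>t. ?\<phi> t * h t) h t = ?\<phi> t * of_real (period_sq ?P h t)" for t
    unfolding bracket_eq_integral bracket_quot_periodic mult.assoc bracket_self[symmetric]
    by (rule integral_mult_right_zero)
  have "l2_inner (\<lambda>t. ?\<phi> t * h t) (\<lambda>t. char_fun b m t * h t)
      = l2_inner (\<lambda>t. indicator {0..<?P} t * bracket ?P (\<lambda>t. ?\<phi> t * h t) h t) (char_on_period b m)"
    by (rule l2_inner_modulate[OF assms(1) L assms(3)])
  also have "\<dots> = l2_inner (\<lambda>t. indicator {0..<?P} t * bracket ?P f h t) (char_on_period b m)"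
    unfolding l2_inner_def
  proof (rule integral_cong_AE)
    show "AE t in lborel. indicator {0..<?P} t * bracket ?P (\<lambda>t. ?\<phi> t * h t) h t * cnj (char_on_period b m t)
        = indicator {0..<?P} t * bracket ?P f h t * cnj (char_on_period b m t)"
      using bracket_quot_mult_period_sq[OF P assms(2,3)] by eventually_elim (simp only: br)
  qed measurable
  also have "\<dots> = l2_inner f (\<lambda>t. char_fun b m t * h t)"
    by (rule l2_inner_modulate[OF assms, symmetric])
  finally show ?thesis
    using L assms by (simp add: l2_inner_diff_left L2_char_fun_mult)
qed

text \<open>The quotient need not be square-integrable on the period, so it cannot be approximated
  directly. Its truncations stay periodic, their products with \<open>h\<close> converge by
  domination, and each bounded truncation is approximated by trigonometric polynomials at cost
  \<open>sqrt C\<close>.\<close>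

lemma bracket_quot_in_closed_span:
  assumes "b > 0" "f \<in> L2" "h \<in> L2" "0 \<le> C" and C: "AE t in lborel. period_sq (1/b) h t \<le> C"
  shows "(\<lambda>t. bracket_quot (1/b) f h t * h t) \<in> l2_closed_span (\<lambda>m t. char_fun b m t * h t)"
  unfolding l2_closed_span_def
proof (intro CollectI conjI allI impI)
  let ?P = "1 / b"
  let ?I = "{0..<?P}"
  have P: "?P > 0" using assms by simp
  let ?\<phi> = "bracket_quot ?P f h"
  show L: "(\<lambda>t. ?\<phi> t * h t) \<in> L2"
    by (rule bracket_quot_mult_L2[OF P assms(2,3)])
  have [measurable]: "h \<in> borel_measurable borel"
    using L2_measurable[OF assms(3)] by simp
  note [measurable] = borel_measurable_bracket_quot[OF assms(2,3)]
  fix e :: real assume "e > 0"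
  define T where "T n t = (if cmod (?\<phi> t) \<le> real n then ?\<phi> t else 0)" for n t
  have [measurable]: "T n \<in> borel_measurable borel" for n
    unfolding T_def[abs_def] by measurable
  have T_per: "T n (t - of_int k * ?P) = T n t" for n t k
    unfolding T_def bracket_quot_periodic ..
  have T_bound: "cmod (T n t) \<le> real n" for n t
    by (simp add: T_def)
  have TL: "(\<lambda>t. indicator ?I t * T n t) \<in> L2" for n
    by (rule L2_indicator_bounded[OF _ T_bound]) measurable
  have ThL: "(\<lambda>t. T n t * h t) \<in> L2" for n
    by (rule L2_mult_bounded(1)[OF assms(3), where K="real n"]) (use T_bound in auto)
  have "(\<lambda>n. l2_norm (\<lambda>t. ?\<phi> t * h t - T n t * h t)) \<longlonglongrightarrow> 0"
  proof (rule l2_norm_dominated_convergence)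
    show "integrable lborel (\<lambda>t. (cmod (?\<phi> t * h t))\<^sup>2)"
      by (rule L2_integrable[OF L])
    show "AE t in lborel. (\<lambda>n. ?\<phi> t * h t - T n t * h t) \<longlonglongrightarrow> 0"
    proof (rule AE_I2)
      fix t
      obtain n0 :: nat where "cmod (?\<phi> t) \<le> real n0"
        using real_arch_simple by blast
      then have "\<forall>n\<ge>n0. ?\<phi> t * h t - T n t * h t = 0"
        by (auto simp: T_def)
      then show "(\<lambda>n. ?\<phi> t * h t - T n t * h t) \<longlonglongrightarrow> 0"
        by (intro tendsto_eventually) (auto simp: eventually_sequentially)
    qed
    show "AE t in lborel. (cmod (?\<phi> t * h t - T n t * h t))\<^sup>2 \<le> (cmod (?\<phi> t * h t))\<^sup>2" for n
      by (simp add: T_def)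
  qed measurable
  then have "\<forall>\<^sub>F n in sequentially. l2_norm (\<lambda>t. ?\<phi> t * h t - T n t * h t) < e / 2"
    using \<open>e > 0\<close> by (intro order_tendstoD(2)) auto
  then obtain n where n: "l2_norm (\<lambda>t. ?\<phi> t * h t - T n t * h t) < e / 2"
    using eventually_happens'[OF sequentially_bot] by blast
  define d where "d = e / 2 / (sqrt C + 1)"
  have sC: "sqrt C + 1 > 0" using \<open>0 \<le> C\<close> by (simp add: add_nonneg_pos)
  have d: "d > 0" using \<open>e > 0\<close> sC by (simp add: d_def)
  \<comment> \<open>The density result takes elements of \<open>L2\<close>, and the periodic
    \<open>T n\<close> is one only after restriction to a period; \<open>eq\<close> removes the
    doubled indicator.\<close>
  obtain p where p: "trig_poly b p" "l2_norm (\<lambda>t. indicator ?I t * (indicator ?I t * T n t - p t)) < d"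
    using trig_poly_dense[OF \<open>b > 0\<close> TL d] by blast
  then obtain F c where F: "finite F" "p = (\<lambda>t. \<Sum>m\<in>F. c m * char_fun b m t)"
    unfolding trig_poly_def by blast
  have [measurable]: "p \<in> borel_measurable borel"
    by (rule trig_poly_measurable[OF p(1)])
  obtain Kp where Kp: "\<And>t. cmod (p t) \<le> Kp"
    using trig_poly_bounded[OF p(1)] by metis
  have Ip: "(\<lambda>t. indicator ?I t * p t) \<in> L2"
    by (rule L2_indicator_bounded[OF _ Kp]) measurable
  have eq: "(\<lambda>t. indicator ?I t * (indicator ?I t * T n t - p t)) = (\<lambda>t. indicator ?I t * (T n t - p t))"
    by (auto split: split_indicator)
  have IL: "(\<lambda>t. indicator ?I t * (T n t - p t)) \<in> L2"
    using L2_diff[OF TL Ip] by (simp only: right_diff_distrib)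
  have per: "T n (t - of_int k * ?P) - p (t - of_int k * ?P) = T n t - p t" for t k
    unfolding F(2) T_per by (simp only: char_fun_periodic[OF \<open>b > 0\<close>])
  have "l2_norm (\<lambda>t. (T n t - p t) * h t) \<le> sqrt C * l2_norm (\<lambda>t. indicator ?I t * (T n t - p t))"
    by (rule periodic_mult_bounded(2)[OF P assms(3-5) _ per IL]) measurable
  also have "\<dots> \<le> (sqrt C + 1) * l2_norm (\<lambda>t. indicator ?I t * (T n t - p t))"
    by (intro mult_right_mono) auto
  also have "\<dots> \<le> (sqrt C + 1) * d"
    using p(2) sC unfolding eq by (intro mult_left_mono) auto
  also have "\<dots> = e / 2"
    using sC unfolding d_def by (subst times_divide_eq_right, subst nonzero_mult_div_cancel_left) auto
  finally have "l2_norm (\<lambda>t. T n t * h t - p t * h t) \<le> e / 2"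
    by (simp add: left_diff_distrib)
  then have "l2_norm (\<lambda>t. ?\<phi> t * h t - p t * h t) < e"
    using l2_norm_triangle_mid[OF L ThL L2_trig_poly_mult[OF p(1) assms(3)], of n] n by simp
  moreover have "p t * h t = (\<Sum>m\<in>F. c m * (char_fun b m t * h t))" for t
    by (simp add: F(2) sum_distrib_right mult.assoc)
  ultimately show "\<exists>F c. finite F \<and> l2_norm (\<lambda>t. ?\<phi> t * h t - (\<Sum>m\<in>F. c m * (char_fun b m t * h t))) < e"
    using F(1) by auto
qed

lemma orth_proj_modulates:
  assumes "b > 0" "f \<in> L2" "h \<in> L2" "0 \<le> C" and C: "AE t in lborel. period_sq (1/b) h t \<le> C"
  shows "orth_proj (l2_closed_span (\<lambda>m t. char_fun b m t * h t)) f \<in> L2"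
    and "AE t in lborel. orth_proj (l2_closed_span (\<lambda>m t. char_fun b m t * h t)) f t = bracket_quot (1/b) f h t * h t"
proof -
  let ?V = "l2_closed_span (\<lambda>m t. char_fun b m t * h t)"
  have P: "1/b > 0" using \<open>b > 0\<close> by simp
  have V: "?V \<subseteq> L2" by (auto simp: l2_closed_span_def)
  have "l2_inner (\<lambda>t. f t - bracket_quot (1/b) f h t * h t) v = 0" if "v \<in> ?V" for v
    by (rule orthogonal_closed_span[OF _ _ _ that])
       (intro L2_char_fun_mult L2_diff bracket_quot_mult_L2 bracket_quot_residual_orthogonal P assms)+
  note * = orth_proj_unique[OF V assms(2) bracket_quot_in_closed_span[OF assms] this]
  show "orth_proj ?V f \<in> L2" using *(1) V by blast
  show "AE t in lborel. orth_proj ?V f t = bracket_quot (1/b) f h t * h t" by (rule *(2))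
qed

section \<open>Weyl--Heisenberg frames\<close>

lemma wh_atom_eq: "wh_atom g a b m n = (\<lambda>t. char_fun b m t * translation (of_int n * a) g t)"
  by (simp add: wh_atom_def modulation_def char_fun_def)

lemma translation_L2:
  assumes "g \<in> L2"
  shows "translation c g \<in> L2"
proof -
  have [measurable]: "g \<in> borel_measurable borel"
    using L2_measurable[OF assms] by simp
  have "(\<integral>\<^sup>+t. ennreal ((cmod (g (t - c)))\<^sup>2) \<partial>lborel) = (\<integral>\<^sup>+t. ennreal ((cmod (g t))\<^sup>2) \<partial>lborel)"
    by (rule nn_integral_translate) measurable
  then show ?thesis
    using assms by (simp add: L2_iff_nn_integral translation_def)
qed

lemma period_sq_translation: "period_sq P (translation c g) t = period_sq P g (t - c)"
  unfolding period_sq_def translation_def by (simp add: algebra_simps)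

text \<open>Finite sums restrict to subfamilies: with index set \<open>F \<times> {n}\<close> the
  same constant serves the modulates of a single translate.\<close>

lemma wh_frame_Bessel:
  assumes "wh_frame g a b"
  obtains B where "0 \<le> B" "\<And>f F. f \<in> L2 \<Longrightarrow> finite F \<Longrightarrow>
    (\<Sum>(m, n)\<in>F. (cmod (l2_inner f (wh_atom g a b m n)))\<^sup>2) \<le> B * (l2_norm f)\<^sup>2"
proof -
  obtain B where B: "B > 0" "\<And>f. f \<in> L2 \<Longrightarrow>
     (\<lambda>(m, n). (cmod (l2_inner f (wh_atom g a b m n)))\<^sup>2) summable_on UNIV \<and>
     (\<Sum>\<^sub>\<infinity>(m, n). (cmod (l2_inner f (wh_atom g a b m n)))\<^sup>2) \<le> B * (l2_norm f)\<^sup>2"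
    using assms unfolding wh_frame_def by blast
  show thesis
  proof (rule that[of B])
    fix f and F :: "(int \<times> int) set" assume f: "f \<in> L2" and F: "finite F"
    have "(\<Sum>(m, n)\<in>F. (cmod (l2_inner f (wh_atom g a b m n)))\<^sup>2)
        \<le> (\<Sum>\<^sub>\<infinity>(m, n). (cmod (l2_inner f (wh_atom g a b m n)))\<^sup>2)"
      using B(2)[OF f] F by (intro finite_sum_le_infsum) auto
    then show "(\<Sum>(m, n)\<in>F. (cmod (l2_inner f (wh_atom g a b m n)))\<^sup>2) \<le> B * (l2_norm f)\<^sup>2"
      using B(2)[OF f] by linarith
  qed (use B(1) in simp)
qed

theorem theorem6p8:
  fixes a b :: real and g :: "real \<Rightarrow> complex"
  assumes "a > 0" and "b > 0" and "g \<in> L2" and "wh_frame g a b"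
  shows "\<forall>f\<in>L2.
     l2_summable (\<lambda>(n::int) t. bracket (1/b) f (translation (of_int n * a) g) t
                                 * translation (of_int n * a) g t) \<and>
     (AE t in lborel. frame_operator g a b f t =
        of_real (1/b) * l2_sum (\<lambda>(n::int) t. bracket (1/b) f (translation (of_int n * a) g) t
                                               * translation (of_int n * a) g t) t) \<and>
     l2_summable (\<lambda>(n::int) t. wh_proj g a b n f t
        * of_real (translation (of_int n * a) (\<lambda>s. (bracket_norm (1/b) g s)\<^sup>2) t)) \<and>
     (AE t in lborel. frame_operator g a b f t =
        of_real (1/b) * l2_sum (\<lambda>(n::int) t. wh_proj g a b n f t
          * of_real (translation (of_int n * a) (\<lambda>s. (bracket_norm (1/b) g s)\<^sup>2) t)) t)"
proof
  fix f :: "real \<Rightarrow> complex" assume f: "f \<in> L2"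
  let ?P = "1 / b"
  have P: "?P > 0" using \<open>b > 0\<close> by simp
  define h where "h n = translation (of_int n * a) g" for n :: int
  have h: "h n \<in> L2" for n
    unfolding h_def by (rule translation_L2[OF \<open>g \<in> L2\<close>])
  have atom: "wh_atom g a b m n = (\<lambda>t. char_fun b m t * h n t)" for m n
    by (simp add: wh_atom_eq h_def)
  obtain B where B: "0 \<le> B" and Bessel: "\<And>f F. f \<in> L2 \<Longrightarrow> finite F \<Longrightarrow>
      (\<Sum>(m, n)\<in>F. (cmod (l2_inner f (wh_atom g a b m n)))\<^sup>2) \<le> B * (l2_norm f)\<^sup>2"
    using wh_frame_Bessel[OF \<open>wh_frame g a b\<close>] by blast
  have C: "AE t in lborel. period_sq ?P (h n) t \<le> B * b" for n
  proof (rule period_sq_bound[OF \<open>b > 0\<close> h B])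
    fix u and F :: "int set" assume u: "u \<in> L2" and F: "finite F"
    have "(\<Sum>m\<in>F. (cmod (l2_inner u (\<lambda>t. char_fun b m t * h n t)))\<^sup>2)
        = (\<Sum>(m, n)\<in>F \<times> {n}. (cmod (l2_inner u (wh_atom g a b m n)))\<^sup>2)"
      by (simp add: atom sum.cartesian_product[symmetric])
    also have "\<dots> \<le> B * (l2_norm u)\<^sup>2"
      using F by (intro Bessel u) auto
    finally show "(\<Sum>m\<in>F. (cmod (l2_inner u (\<lambda>t. char_fun b m t * h n t)))\<^sup>2) \<le> B * (l2_norm u)\<^sup>2" .
  qed
  have Bb: "0 \<le> B * b" using B \<open>b > 0\<close> by simp
  define S where "S = frame_operator g a b f"
  have "l2_summable (\<lambda>p t. l2_inner f ((\<lambda>(m, n). wh_atom g a b m n) p) * (\<lambda>(m, n). wh_atom g a b m n) p t)"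
    by (rule Bessel_summable[OF _ B f])
       (use Bessel in \<open>auto simp: atom case_prod_beta intro!: L2_char_fun_mult h\<close>)
  then have "l2_has_sum (\<lambda>(m, n) t. l2_inner f (wh_atom g a b m n) * wh_atom g a b m n t) S"
    unfolding S_def frame_operator_def by (intro l2_has_sum_l2_sum) (simp add: case_prod_beta')
  \<comment> \<open>The inner sums run over the modulations \<open>m\<close>, the outer index is the
    translation \<open>n\<close>.\<close>
  then have "l2_has_sum (\<lambda>n t. of_real ?P * (bracket ?P f (h n) t * h n t)) S"
    by (rule l2_has_sum_Sigma) (use modulates_l2_has_sum[OF \<open>b > 0\<close> f h Bb C] in \<open>simp add: atom\<close>)
  \<comment> \<open>Scaling by \<open>b\<close> clears \<open>1/b\<close> from the terms, since the
    asserted series carries that factor outside the sum.\<close>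
  from l2_has_sum_cmult[OF this, of "of_real b"]
  have sum1: "l2_has_sum (\<lambda>n t. bracket ?P f (h n) t * h n t) (\<lambda>t. of_real b * S t)"
    using \<open>b > 0\<close> by simp
  define u where "u n t = wh_proj g a b n f t * of_real (translation (of_int n * a) (\<lambda>s. (bracket_norm ?P g s)\<^sup>2) t)"
    for n t
  have weight: "translation (of_int n * a) (\<lambda>s. (bracket_norm ?P g s)\<^sup>2) t = period_sq ?P (h n) t" for n t
    unfolding h_def period_sq_translation by (simp add: translation_def bracket_norm_def bracket_self)
  have proj: "wh_proj g a b n f = orth_proj (l2_closed_span (\<lambda>m t. char_fun b m t * h n t)) f" for n
    by (simp add: wh_proj_def atom)
  \<comment> \<open>Multiplying the projection by the weight cancels the denominator of the
    quotient, so the terms of the two series agree almost everywhere.\<close>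
  have u_AE: "AE t in lborel. u n t = bracket ?P f (h n) t * h n t" for n
    using orth_proj_modulates(2)[OF \<open>b > 0\<close> f h Bb C, of n] bracket_quot_mult_period_sq[OF P f h[of n]]
    unfolding u_def weight proj by eventually_elim (simp add: mult_ac)
  have u_L2: "u n \<in> L2" for n
  proof (rule l2_norm_cong_AE(1))
    show "(\<lambda>t. bracket ?P f (h n) t * h n t) \<in> L2"
      by (rule bracket_mult_L2[OF P f h Bb C])
    have [measurable]: "wh_proj g a b n f \<in> borel_measurable borel" "h n \<in> borel_measurable borel"
      using orth_proj_modulates(1)[OF \<open>b > 0\<close> f h Bb C, of n] h[of n] unfolding proj
      by (auto dest: L2_measurable)
    note [measurable] = borel_measurable_period_sq
    show "u n \<in> borel_measurable lborel"
      unfolding u_def[abs_def] weight by measurable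
    show "AE t in lborel. bracket ?P f (h n) t * h n t = u n t"
      using u_AE[of n] by eventually_elim simp
  qed
  have sum2: "l2_has_sum u (\<lambda>t. of_real b * S t)"
    by (rule l2_has_sum_cong_AE[OF sum1 u_L2 u_AE])
  \<comment> \<open>\<open>l2_sum\<close> is some chosen sum, so uniqueness ties it to
    \<open>b * S\<close> almost everywhere only.\<close>
  have result: "l2_summable v \<and> (AE t in lborel. S t = of_real ?P * l2_sum v t)"
    if "l2_has_sum v (\<lambda>t. of_real b * S t)" for v :: "int \<Rightarrow> real \<Rightarrow> complex"
  proof
    show v: "l2_summable v" using that by (auto simp: l2_summable_def)
    show "AE t in lborel. S t = of_real ?P * l2_sum v t"
      using l2_has_sum_unique[OF l2_has_sum_l2_sum[OF v] that]
      by eventually_elim (use \<open>b > 0\<close> in simp)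
  qed
  from result[OF sum1] result[OF sum2]
  show "l2_summable (\<lambda>(n::int) t. bracket (1/b) f (translation (of_int n * a) g) t
                                 * translation (of_int n * a) g t) \<and>
     (AE t in lborel. frame_operator g a b f t =
        of_real (1/b) * l2_sum (\<lambda>(n::int) t. bracket (1/b) f (translation (of_int n * a) g) t
                                               * translation (of_int n * a) g t) t) \<and>
     l2_summable (\<lambda>(n::int) t. wh_proj g a b n f t
        * of_real (translation (of_int n * a) (\<lambda>s. (bracket_norm (1/b) g s)\<^sup>2) t)) \<and>
     (AE t in lborel. frame_operator g a b f t =
        of_real (1/b) * l2_sum (\<lambda>(n::int) t. wh_proj g a b n f t
          * of_real (translation (of_int n * a) (\<lambda>s. (bracket_norm (1/b) g s)\<^sup>2) t)) t)"
    unfolding S_def h_def u_def[abs_def] by blast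
qed

end
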